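(* Let $k$ be a field, $R$ a factorial affine $k$-domain and $K=\mathrm{Frac}(R)$. Let $d,e$ be positive integers, let $$P(X,Z)=a_0(X)+a_1(X)Z+\cdots+Z^m\in R[X,Z]$$ be monic in $Z$ of degree $m$, and let $$Q(X,Y,Z)=b_0(X,Z)+b_1(X,Z)Y+\cdots+b_sY^s\in R[X,Y,Z],\quad s\geq 1,$$ where $a_i\in R[X]$, $b_i\in R[X,Z]$ for $0\leq i\leq s-1$ and $b_s\in R\setminus\{0\}$. Define $$P'(X,Z)=a_1(X)+2a_2(X)Z+\cdots+mZ^{m-1},\qquad Q'(X,Y,Z)=b_1(X,Z)+2b_2(X,Z)Y+\cdots+sb_sY^{s-1}.$$ For each integer $j\geq 1$ put $$B_{d,j}^R:=\frac{R[X,Y,Z,T]}{(X^dY-P(X,Z),\ X^jT-Q(X,Y,Z))}.$$ Suppose that $e>1$, $\deg_ZP(X,Z)>1$, $(P(0,Z),P'(0,Z))=R[Z]$ and $(P(0,Z),Q(0,Y,Z),Q'(0,Y,Z))=R[Y,Z]$. Then $$(B_{d,e}^R)^{[1]}\cong_R(B_{d,e-1}^R)^{[1]}.$$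
   Context: All rings are commutative Noetherian with unity. $A^{[1]}$ denotes the polynomial ring in one variable over $A$, and $\cong_R$ denotes isomorphism of $R$-algebras. A factorial affine $k$-domain is a unique factorization domain that is finitely generated as a $k$-algebra. $X,Y,Z,T$ are indeterminates over $R$. $P'$ and $Q'$ are the formal partial derivatives of $P$ with respect to $Z$ and of $Q$ with respect to $Y$. *)

theory Defs
  imports
    "HOL-Algebra.UnivPoly"
    "HOL-Algebra.QuotRing"
    "HOL-Algebra.Generated_Rings"
    "HOL-Algebra.Ring_Divisibility"
begin

text \<open>
  Polynomial rings in several variables are iterated univariate ones, in the variable order
  \<open>X, Z, Y, T\<close>: \<open>R[X] = UP R\<close>, \<open>R[X,Z] = UP (UP R)\<close>, \<open>R[X,Y,Z] = UP (UP (UP R))\<close> and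
  \<open>R[X,Y,Z,T] = UP (UP (UP (UP R)))\<close>. So an element of \<open>R[X,Z]\<close> is a polynomial in \<open>Z\<close> over
  \<open>R[X]\<close>, and an element of \<open>R[X,Y,Z]\<close> a polynomial in \<open>Y\<close> over \<open>R[X,Z]\<close>.
\<close>

definition factorial_affine_domain ::
    "('k, 'n) ring_scheme \<Rightarrow> ('k, 'a, 'm) module_scheme \<Rightarrow> bool" where
  "factorial_affine_domain k R \<longleftrightarrow>
     algebra k R \<and> factorial_domain R \<and>
     (\<exists>S. finite S \<and> S \<subseteq> carrier R \<and>
          generate_ring R ((\<lambda>c. c \<odot>\<^bsub>R\<^esub> \<one>\<^bsub>R\<^esub>) ` carrier k \<union> S) = carrier R)"

text \<open>For a coefficient ring \<open>A\<close>, the constant polynomial \<open>a\<close> and the variable in \<open>UP A\<close>.\<close>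

definition cst :: "('a, 'm) ring_scheme \<Rightarrow> 'a \<Rightarrow> nat \<Rightarrow> 'a" where
  "cst A a = monom (UP A) a 0"

definition var :: "('a, 'm) ring_scheme \<Rightarrow> nat \<Rightarrow> 'a" where
  "var A = monom (UP A) \<one>\<^bsub>A\<^esub> 1"

definition formal_deriv :: "('a, 'm) ring_scheme \<Rightarrow> (nat \<Rightarrow> 'a) \<Rightarrow> nat \<Rightarrow> 'a" where
  "formal_deriv A p =
     (\<Oplus>\<^bsub>UP A\<^esub>i\<in>{1..deg A p}. monom (UP A) ([i] \<cdot>\<^bsub>A\<^esub> coeff (UP A) p i) (i - 1))"

text \<open>The map \<open>UP A \<rightarrow> UP B\<close> that applies \<open>h : A \<rightarrow> B\<close> to the coefficients and fixes the variable.\<close>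

definition map_coeffs ::
    "('a, 'm) ring_scheme \<Rightarrow> ('b, 'n) ring_scheme \<Rightarrow> ('a \<Rightarrow> 'b) \<Rightarrow> (nat \<Rightarrow> 'a) \<Rightarrow> nat \<Rightarrow> 'b" where
  "map_coeffs A B h = eval A (UP B) (\<lambda>a. cst B (h a)) (var B)"

text \<open>
  The substitution \<open>X = 0\<close>, as maps \<open>R[X] \<rightarrow> R\<close>, \<open>R[X,Z] \<rightarrow> R[Z]\<close> and \<open>R[X,Y,Z] \<rightarrow> R[Y,Z]\<close>, where
  \<open>R[Z] = UP R\<close> and \<open>R[Y,Z] = UP (UP R)\<close> (polynomials in \<open>Y\<close> over \<open>R[Z]\<close>).
\<close>

definition subst0_X :: "('a, 'm) ring_scheme \<Rightarrow> (nat \<Rightarrow> 'a) \<Rightarrow> 'a" where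
  "subst0_X R = eval R R (\<lambda>r. r) \<zero>\<^bsub>R\<^esub>"

definition subst0_XZ ::
    "('a, 'm) ring_scheme \<Rightarrow> (nat \<Rightarrow> nat \<Rightarrow> 'a) \<Rightarrow> nat \<Rightarrow> 'a" where
  "subst0_XZ R = map_coeffs (UP R) R (subst0_X R)"

definition subst0_XYZ ::
    "('a, 'm) ring_scheme \<Rightarrow> (nat \<Rightarrow> nat \<Rightarrow> nat \<Rightarrow> 'a) \<Rightarrow> nat \<Rightarrow> nat \<Rightarrow> 'a" where
  "subst0_XYZ R = map_coeffs (UP (UP R)) (UP R) (subst0_XZ R)"

text \<open>The polynomials \<open>X^d Y - P(X,Z)\<close> and \<open>X^j T - Q(X,Y,Z)\<close> in \<open>R[X,Y,Z,T]\<close>.\<close>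

definition rel1 ::
    "('a, 'm) ring_scheme \<Rightarrow> nat \<Rightarrow> (nat \<Rightarrow> nat \<Rightarrow> 'a) \<Rightarrow> nat \<Rightarrow> nat \<Rightarrow> nat \<Rightarrow> nat \<Rightarrow> 'a" where
  "rel1 R d P =
    (let RX = UP R; RXZ = UP RX; RXYZ = UP RXZ; S = UP RXYZ;
         X = cst RXYZ (cst RXZ (cst RX (var R)));
         Y = cst RXYZ (var RXZ)
     in X [^]\<^bsub>S\<^esub> d \<otimes>\<^bsub>S\<^esub> Y \<ominus>\<^bsub>S\<^esub> cst RXYZ (cst RXZ P))"

definition rel2 ::
    "('a, 'm) ring_scheme \<Rightarrow> nat \<Rightarrow> (nat \<Rightarrow> nat \<Rightarrow> nat \<Rightarrow> 'a) \<Rightarrow> nat \<Rightarrow> nat \<Rightarrow> nat \<Rightarrow> nat \<Rightarrow> 'a" where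
  "rel2 R j Q =
    (let RX = UP R; RXZ = UP RX; RXYZ = UP RXZ; S = UP RXYZ;
         X = cst RXYZ (cst RXZ (cst RX (var R)));
         T = var RXYZ
     in X [^]\<^bsub>S\<^esub> j \<otimes>\<^bsub>S\<^esub> T \<ominus>\<^bsub>S\<^esub> cst RXYZ Q)"

definition B_ideal ::
    "('a, 'm) ring_scheme \<Rightarrow> nat \<Rightarrow> nat \<Rightarrow> (nat \<Rightarrow> nat \<Rightarrow> 'a) \<Rightarrow> (nat \<Rightarrow> nat \<Rightarrow> nat \<Rightarrow> 'a)
      \<Rightarrow> (nat \<Rightarrow> nat \<Rightarrow> nat \<Rightarrow> nat \<Rightarrow> 'a) set" where
  "B_ideal R d j P Q = Idl\<^bsub>UP (UP (UP (UP R)))\<^esub> {rel1 R d P, rel2 R j Q}"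

definition B_ring ::
    "('a, 'm) ring_scheme \<Rightarrow> nat \<Rightarrow> nat \<Rightarrow> (nat \<Rightarrow> nat \<Rightarrow> 'a) \<Rightarrow> (nat \<Rightarrow> nat \<Rightarrow> nat \<Rightarrow> 'a)
      \<Rightarrow> (nat \<Rightarrow> nat \<Rightarrow> nat \<Rightarrow> nat \<Rightarrow> 'a) set ring" where
  "B_ring R d j P Q = UP (UP (UP (UP R))) Quot B_ideal R d j P Q"

text \<open>The structure map \<open>R \<rightarrow> B\<close> of the \<open>R\<close>-algebra \<open>B\<close>.\<close>

definition B_incl ::
    "('a, 'm) ring_scheme \<Rightarrow> nat \<Rightarrow> nat \<Rightarrow> (nat \<Rightarrow> nat \<Rightarrow> 'a) \<Rightarrow> (nat \<Rightarrow> nat \<Rightarrow> nat \<Rightarrow> 'a)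
      \<Rightarrow> 'a \<Rightarrow> (nat \<Rightarrow> nat \<Rightarrow> nat \<Rightarrow> nat \<Rightarrow> 'a) set" where
  "B_incl R d j P Q r =
     B_ideal R d j P Q +>\<^bsub>UP (UP (UP (UP R)))\<^esub>
       cst (UP (UP (UP R))) (cst (UP (UP R)) (cst (UP R) (cst R r)))"

text \<open>
  Isomorphism over \<open>R\<close> of two \<open>R\<close>-algebras, given as rings \<open>A\<close>, \<open>A'\<close> with structure maps
  \<open>\<alpha> : R \<rightarrow> A\<close> and \<open>\<alpha>' : R \<rightarrow> A'\<close>.
\<close>

definition alg_isomorphic ::
    "('a, 'm) ring_scheme \<Rightarrow> ('b, 'n) ring_scheme \<Rightarrow> ('a \<Rightarrow> 'b)
      \<Rightarrow> ('c, 'o) ring_scheme \<Rightarrow> ('a \<Rightarrow> 'c) \<Rightarrow> bool" where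
  "alg_isomorphic R A \<alpha> A' \<alpha>' \<longleftrightarrow>
     (\<exists>h \<in> ring_iso A A'. \<forall>r \<in> carrier R. h (\<alpha> r) = \<alpha>' r)"

end

theory Submission
  imports Defs "HOL-Algebra.Multiplicative_Group"
begin

text \<open>
  Write \<open>B_j\<close> for \<open>B_ring R d j P Q\<close>. Where \<open>X\<close> is invertible, \<open>B_j\<close> is \<open>R[X, 1/X, Z]\<close>, because
  \<open>Y = P/X^d\<close> and \<open>T = Q/X^j\<close>. A translation \<open>Z \<mapsto> Z + X^(d+j) \<tau>\<close> extends to an action of the
  additive group on \<open>Spec B_j\<close>; modulo \<open>X\<close> it moves \<open>T\<close> by \<open>P' Q' \<tau>\<close>, and \<open>P' Q'\<close> is a unit there
  by the two unit ideal hypotheses, so the action is free. The quotient is the affine line over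
  \<open>Spec R\<close> with the locus \<open>X = 0\<close> replaced by the solutions of \<open>P(0,Z) = Q(0,Y,Z) = 0\<close>; this
  (non-separated) object is the same for every \<open>j \<ge> 1\<close>. Hence the fibre product of \<open>Spec B_(j+1)\<close>
  and \<open>Spec B_j\<close> over it is a torsor under the additive group over either factor. Such torsors over
  affine schemes are trivial, so the fibre product is the cylinder over both. This is Danielewski's
  argument; here it is carried out with explicit formulas for the fibre product.

  A point of the fibre product is a point \<open>(x, z, y, t)\<close> of \<open>Spec B_(j+1)\<close> together with a parameter
  \<open>u\<close>. Its second projection \<open>(x, z', y', t')\<close> is determined by \<open>z' = z + x^(d+j) u\<close>, since Taylor
  expansion shows that \<open>P(x, z')\<close> is again divisible by \<open>x^d\<close>, and \<open>Q\<close> at the new point by \<open>x^j\<close>: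
    \<^item> \<open>y' = y + x^j u w(x, z, u)\<close>,
    \<^item> \<open>t' = x t + u (c + x g(x, z, u, y))\<close>, where \<open>c = P'(x, z') Q'(x, y', z')\<close>,
  for fixed polynomials \<open>w\<close> and \<open>g\<close> (lemma \<open>translation_polynomials_exist\<close>). With \<open>s = t + u g\<close> the
  last equation becomes \<open>x s + c u = t'\<close>. So over \<open>Spec B_j\<close> the fibre product is the space of
  solutions \<open>(s, u)\<close> of a single linear equation, and the row \<open>(x, c)\<close> is unimodular over \<open>B_j\<close>: there
  are polynomials \<open>a\<close>, \<open>b\<close> with \<open>x a + b c = 1\<close> on \<open>Spec B_j\<close> (lemma \<open>bezout_in_B\<close>). Such
  an equation has the solutions \<open>s = a t' + c v\<close>, \<open>u = b t' - x v\<close> with the single free parameter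
  \<open>v = b s - a u\<close> (lemmas \<open>solve_linear\<close> and \<open>solve_linear'\<close>). Thus
  \<open>(x, z, y, t, u) \<mapsto> (x, z', y', t', v)\<close> is a bijection between the points of the two cylinders.

  The bijection holds for points with coordinates in an arbitrary commutative \<open>R\<close>-algebra \<open>M\<close>, and
  it is natural in \<open>M\<close>, since it is given by fixed polynomials. The cylinder \<open>B_j[V]\<close> represents the
  functor of its points (lemmas \<open>hom_from_cylinder\<close> and \<open>cylinder_hom_eqI\<close>), so the bijection comes
  from an isomorphism of \<open>R\<close>-algebras, as in Yoneda's lemma.
\<close>

section \<open>Evaluation homomorphisms\<close>

lemma cring_UP: "cring A \<Longrightarrow> cring (UP A)"
  by (intro UP_cring.UP_cring UP_cring.intro)

context ring_hom_cring
begin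

lemma UP_pre_univ_prop: "UP_pre_univ_prop R S h"
  by (intro UP_pre_univ_prop.intro UP_cring.intro) (rule ring_hom_cring_axioms, rule R.is_cring)

lemma cst_closed [simp]: "a \<in> carrier R \<Longrightarrow> cst R a \<in> carrier (UP R)"
  unfolding cst_def using UP_pre_univ_prop
  by (simp add: UP_ring.monom_closed UP_ring_def R.ring_axioms)

lemma var_closed [simp]: "var R \<in> carrier (UP R)"
  unfolding var_def by (simp add: UP_ring.monom_closed UP_ring_def R.ring_axioms)

lemma eval_is_hom:
  assumes "s \<in> carrier S"
  shows "ring_hom_cring (UP R) S (eval R S h s)"
  using UP_pre_univ_prop.eval_ring_hom[OF UP_pre_univ_prop assms]
  by (intro ring_hom_cringI cring_UP R.is_cring S.is_cring)

lemma eval_cst [simp]: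
  "\<lbrakk>s \<in> carrier S; a \<in> carrier R\<rbrakk> \<Longrightarrow> eval R S h s (cst R a) = h a"
  unfolding cst_def by (rule UP_pre_univ_prop.eval_const[OF UP_pre_univ_prop])

lemma eval_var [simp]: "s \<in> carrier S \<Longrightarrow> eval R S h s (var R) = s"
  unfolding var_def by (rule UP_pre_univ_prop.eval_monom1[OF UP_pre_univ_prop])

end

lemma cst_is_hom:
  assumes "cring A"
  shows "ring_hom_cring A (UP A) (cst A)"
proof (rule ring_hom_cringI[OF assms cring_UP[OF assms]])
  show "cst A \<in> ring_hom A (UP A)"
    using UP_ring.const_ring_hom[of A] assms unfolding cst_def
    by (simp add: UP_ring_def cring_def)
qed

text \<open>
  Homomorphisms out of a polynomial ring are compared on constants and on the variable. The
  analogues for iterated polynomial rings below are the uniqueness half of every universal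
  property that is used.
\<close>

lemma hom_UP_eqI:
  assumes "cring A" "cring M"
    and f: "f \<in> ring_hom (UP A) M" and g: "g \<in> ring_hom (UP A) M"
    and c: "\<And>a. a \<in> carrier A \<Longrightarrow> f (cst A a) = g (cst A a)"
    and v: "f (var A) = g (var A)"
    and p: "p \<in> carrier (UP A)"
  shows "f p = g p"
proof -
  interpret A: cring A by fact
  interpret M: cring M by fact
  interpret F: ring_hom_cring "UP A" M f using assms cring_UP by (intro ring_hom_cringI)
  interpret G: ring_hom_cring "UP A" M g using assms cring_UP by (intro ring_hom_cringI)
  interpret C: ring_hom_cring A "UP A" "cst A" by (rule cst_is_hom) fact
  have "(\<lambda>a. g (cst A a)) \<in> ring_hom A M"
    by (auto intro!: ring_hom_memI)
  then interpret H: ring_hom_cring A M "\<lambda>a. g (cst A a)"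
    by (intro ring_hom_cringI A.is_cring M.is_cring)
  have var: "var A = monom (UP A) \<one>\<^bsub>A\<^esub> (Suc 0)" by (simp add: var_def)
  show ?thesis
  proof (rule UP_pre_univ_prop.UP_hom_unique[OF H.UP_pre_univ_prop])
    show "f (monom (UP A) \<one>\<^bsub>A\<^esub> (Suc 0)) = g (var A)" using v unfolding var .
    show "g (monom (UP A) \<one>\<^bsub>A\<^esub> (Suc 0)) = g (var A)" unfolding var ..
    show "f (monom (UP A) a 0) = g (cst A a)" if "a \<in> carrier A" for a
      using c[OF that] unfolding cst_def .
    show "g (monom (UP A) a 0) = g (cst A a)" for a unfolding cst_def ..
    show "g (var A) \<in> carrier M" using H.var_closed by (rule G.hom_closed)
  qed (fact F.ring_hom_cring_axioms G.ring_hom_cring_axioms p)+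
qed

text \<open>
  Naturality of evaluation. This lemma and its versions for several variables are what makes the
  maps between point sets commute with ring homomorphisms.
\<close>

lemma hom_eval:
  assumes "ring_hom_cring A M h" "ring_hom_cring A N k" "ring_hom_cring M N f"
    and s: "s \<in> carrier M"
    and hk: "\<And>a. a \<in> carrier A \<Longrightarrow> f (h a) = k a"
    and p: "p \<in> carrier (UP A)"
  shows "f (eval A M h s p) = eval A N k (f s) p"
proof -
  interpret h: ring_hom_cring A M h by fact
  interpret k: ring_hom_cring A N k by fact
  interpret f: ring_hom_cring M N f by fact
  interpret E: ring_hom_cring "UP A" M "eval A M h s" by (rule h.eval_is_hom[OF s])
  interpret E': ring_hom_cring "UP A" N "eval A N k (f s)" by (rule k.eval_is_hom) (simp add: s)
  have "(\<lambda>p. f (eval A M h s p)) \<in> ring_hom (UP A) N"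
    by (auto intro!: ring_hom_memI)
  then show ?thesis
    by (rule hom_UP_eqI[OF h.R.is_cring k.S.is_cring _ E'.homh _ _ p]) (auto simp: s hk)
qed

lemma eval_at_generic:
  assumes A: "cring A" and p: "p \<in> carrier (UP A)"
  shows "eval A (UP A) (cst A) (var A) p = p"
proof -
  interpret c: ring_hom_cring A "UP A" "cst A" by (rule cst_is_hom[OF A])
  have i: "(\<lambda>p. p) \<in> ring_hom (UP A) (UP A)" by (rule ring_hom_memI) auto
  show ?thesis
    by (rule hom_UP_eqI[OF A c.S.is_cring ring_hom_cring.homh[OF c.eval_is_hom] i _ _ p]) auto
qed

section \<open>Taylor expansion of evaluated polynomials\<close>

context ring_hom_cring
begin

lemma eval_sum:
  assumes "p \<in> carrier (UP R)"
  shows "eval R S h s p = (\<Oplus>\<^bsub>S\<^esub>i\<in>{..deg R p}. h (coeff (UP R) p i) \<otimes>\<^bsub>S\<^esub> s [^]\<^bsub>S\<^esub> i)"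
  by (rule UP.eval_on_carrier[OF assms])

lemma coeff_UP_closed [simp]: "p \<in> carrier (UP R) \<Longrightarrow> coeff (UP R) p i \<in> carrier R"
  by (rule UP.coeff_closed)

lemma formal_deriv_closed [simp]:
  "p \<in> carrier (UP R) \<Longrightarrow> formal_deriv R p \<in> carrier (UP R)"
proof -
  assume p: "p \<in> carrier (UP R)"
  interpret U: cring "UP R" by (rule cring_UP[OF R.is_cring])
  interpret U: UP_ring R "UP R" by (simp_all add: UP_ring_def R.ring_axioms)
  show ?thesis unfolding formal_deriv_def
    by (rule U.finsum_closed) (simp add: p)
qed

lemma power_taylor:
  assumes z: "z \<in> carrier S" and k: "k \<in> carrier S"
  shows "\<exists>r\<in>carrier S. (z \<oplus>\<^bsub>S\<^esub> k) [^]\<^bsub>S\<^esub> (i::nat) =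
    z [^]\<^bsub>S\<^esub> i \<oplus>\<^bsub>S\<^esub> k \<otimes>\<^bsub>S\<^esub> ([i] \<cdot>\<^bsub>S\<^esub> (z [^]\<^bsub>S\<^esub> (i - 1))) \<oplus>\<^bsub>S\<^esub> k \<otimes>\<^bsub>S\<^esub> k \<otimes>\<^bsub>S\<^esub> r"
proof (induction i)
  case 0
  have "[(0::nat)] \<cdot>\<^bsub>S\<^esub> (z [^]\<^bsub>S\<^esub> (0 - 1 :: nat)) = \<zero>\<^bsub>S\<^esub>"
    by simp
  then show ?case using assms by (intro bexI[of _ "\<zero>\<^bsub>S\<^esub>"]) simp_all
next
  case (Suc i)
  then obtain r where r: "r \<in> carrier S" and
    e: "(z \<oplus>\<^bsub>S\<^esub> k) [^]\<^bsub>S\<^esub> i = z [^]\<^bsub>S\<^esub> i \<oplus>\<^bsub>S\<^esub> k \<otimes>\<^bsub>S\<^esub> ([i] \<cdot>\<^bsub>S\<^esub> (z [^]\<^bsub>S\<^esub> (i - 1))) \<oplus>\<^bsub>S\<^esub> k \<otimes>\<^bsub>S\<^esub> k \<otimes>\<^bsub>S\<^esub> r"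
    by blast
  define D where "D = [i] \<cdot>\<^bsub>S\<^esub> (z [^]\<^bsub>S\<^esub> (i - 1))"
  have D: "D \<in> carrier S" unfolding D_def using z by simp
  define Z where "Z = z [^]\<^bsub>S\<^esub> i"
  have Z: "Z \<in> carrier S" unfolding Z_def using z by simp
  have iD: "D \<otimes>\<^bsub>S\<^esub> z = [i] \<cdot>\<^bsub>S\<^esub> Z"
  proof (cases i)
    case 0
    then show ?thesis using z unfolding D_def Z_def by simp
  next
    case (Suc m)
    show ?thesis unfolding D_def Z_def Suc
      using S.add_pow_ldistr[of "z [^]\<^bsub>S\<^esub> m" z "Suc m"] z
      by (simp only: diff_Suc_1 S.nat_pow_Suc S.nat_pow_closed)
  qed
  have D': "[Suc i] \<cdot>\<^bsub>S\<^esub> (z [^]\<^bsub>S\<^esub> (Suc i - 1)) = D \<otimes>\<^bsub>S\<^esub> z \<oplus>\<^bsub>S\<^esub> Z"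
    unfolding iD using Z by (simp add: Z_def[symmetric])
  have "(z \<oplus>\<^bsub>S\<^esub> k) [^]\<^bsub>S\<^esub> Suc i = (Z \<oplus>\<^bsub>S\<^esub> k \<otimes>\<^bsub>S\<^esub> D \<oplus>\<^bsub>S\<^esub> k \<otimes>\<^bsub>S\<^esub> k \<otimes>\<^bsub>S\<^esub> r) \<otimes>\<^bsub>S\<^esub> (z \<oplus>\<^bsub>S\<^esub> k)"
    using e by (simp add: D_def Z_def)
  also have "\<dots> = Z \<otimes>\<^bsub>S\<^esub> z \<oplus>\<^bsub>S\<^esub> k \<otimes>\<^bsub>S\<^esub> (D \<otimes>\<^bsub>S\<^esub> z \<oplus>\<^bsub>S\<^esub> Z) \<oplus>\<^bsub>S\<^esub>
      k \<otimes>\<^bsub>S\<^esub> k \<otimes>\<^bsub>S\<^esub> (D \<oplus>\<^bsub>S\<^esub> r \<otimes>\<^bsub>S\<^esub> (z \<oplus>\<^bsub>S\<^esub> k))"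
    using Z D r z k by algebra
  finally show ?case unfolding D' using Z D r z k
    by (intro bexI[of _ "D \<oplus>\<^bsub>S\<^esub> r \<otimes>\<^bsub>S\<^esub> (z \<oplus>\<^bsub>S\<^esub> k)"]) (simp_all add: Z_def)
qed

text \<open>
  The sum may start at \<open>0\<close> instead of \<open>1\<close>, which lines it up with the sum for the
  polynomial itself: the term for \<open>i = 0\<close> vanishes because of the factor \<open>[0]\<close>.
\<close>

lemma eval_formal_deriv:
  assumes p: "p \<in> carrier (UP R)" and z: "z \<in> carrier S"
  shows "eval R S h z (formal_deriv R p) =
    (\<Oplus>\<^bsub>S\<^esub>i\<in>{..deg R p}. h (coeff (UP R) p i) \<otimes>\<^bsub>S\<^esub> ([i] \<cdot>\<^bsub>S\<^esub> (z [^]\<^bsub>S\<^esub> (i - 1))))"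
proof -
  interpret E: ring_hom_cring "UP R" S "eval R S h z" by (rule eval_is_hom[OF z])
  have mc: "monom (UP R) ([i] \<cdot> coeff (UP R) p i) (i - 1) \<in> carrier (UP R)" for i
    by (rule UP_ring.monom_closed) (auto simp: UP_ring_def R.ring_axioms p)
  have hp: "h ([i] \<cdot> a) = [i] \<cdot>\<^bsub>S\<^esub> h a" if "a \<in> carrier R" for a and i :: nat
    using that by (induction i) auto
  have ev: "eval R S h z (monom (UP R) ([i] \<cdot> coeff (UP R) p i) (i - 1)) =
     h (coeff (UP R) p i) \<otimes>\<^bsub>S\<^esub> ([i] \<cdot>\<^bsub>S\<^esub> (z [^]\<^bsub>S\<^esub> (i - 1)))" for i
    using p z
    by (subst UP_pre_univ_prop.eval_monom[OF UP_pre_univ_prop])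
       (simp_all add: hp S.add_pow_ldistr S.add_pow_rdistr)
  have "eval R S h z (formal_deriv R p) =
    (\<Oplus>\<^bsub>S\<^esub>i\<in>{1..deg R p}. h (coeff (UP R) p i) \<otimes>\<^bsub>S\<^esub> ([i] \<cdot>\<^bsub>S\<^esub> (z [^]\<^bsub>S\<^esub> (i - 1))))"
    unfolding formal_deriv_def ev[symmetric] using mc
    by (subst E.hom_finsum) (auto simp: comp_def)
  also have "\<dots> = (\<Oplus>\<^bsub>S\<^esub>i\<in>{..deg R p}. h (coeff (UP R) p i) \<otimes>\<^bsub>S\<^esub> ([i] \<cdot>\<^bsub>S\<^esub> (z [^]\<^bsub>S\<^esub> (i - 1))))"
    by (rule S.add.finprod_mono_neutral_cong_left) (auto simp: p z not_less_eq_eq)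
  finally show ?thesis .
qed

text \<open>
  The binomial expansion \<open>power_taylor\<close>, applied to each monomial. Only the existence of a
  remainder divisible by \<open>k^2\<close> is recorded, so that no higher derivatives, and hence no divisions by
  factorials, occur; the expansion holds in every characteristic.
\<close>

lemma eval_taylor:
  assumes p: "p \<in> carrier (UP R)" and z: "z \<in> carrier S" and k: "k \<in> carrier S"
  shows "\<exists>r\<in>carrier S. eval R S h (z \<oplus>\<^bsub>S\<^esub> k) p =
    eval R S h z p \<oplus>\<^bsub>S\<^esub> k \<otimes>\<^bsub>S\<^esub> eval R S h z (formal_deriv R p) \<oplus>\<^bsub>S\<^esub> k \<otimes>\<^bsub>S\<^esub> k \<otimes>\<^bsub>S\<^esub> r"
proof -
  obtain r where r: "\<And>i. r i \<in> carrier S" and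
    e: "\<And>i::nat. (z \<oplus>\<^bsub>S\<^esub> k) [^]\<^bsub>S\<^esub> i =
      z [^]\<^bsub>S\<^esub> i \<oplus>\<^bsub>S\<^esub> k \<otimes>\<^bsub>S\<^esub> ([i] \<cdot>\<^bsub>S\<^esub> (z [^]\<^bsub>S\<^esub> (i - 1))) \<oplus>\<^bsub>S\<^esub> k \<otimes>\<^bsub>S\<^esub> k \<otimes>\<^bsub>S\<^esub> r i"
    using power_taylor[OF z k] by metis
  define c where "c i = h (coeff (UP R) p i)" for i
  have c: "c i \<in> carrier S" for i unfolding c_def using p by simp
  define q where "q i = z [^]\<^bsub>S\<^esub> i" for i :: nat
  have q: "q i \<in> carrier S" for i unfolding q_def using z by simp
  define D where "D i = [i] \<cdot>\<^bsub>S\<^esub> (z [^]\<^bsub>S\<^esub> (i - 1))" for i :: nat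
  have D: "D i \<in> carrier S" for i unfolding D_def using z by simp
  have "eval R S h (z \<oplus>\<^bsub>S\<^esub> k) p = (\<Oplus>\<^bsub>S\<^esub>i\<in>{..deg R p}. c i \<otimes>\<^bsub>S\<^esub> (q i \<oplus>\<^bsub>S\<^esub> k \<otimes>\<^bsub>S\<^esub> D i \<oplus>\<^bsub>S\<^esub> k \<otimes>\<^bsub>S\<^esub> k \<otimes>\<^bsub>S\<^esub> r i))"
    unfolding eval_sum[OF p] e c_def q_def D_def ..
  also have "\<dots> = (\<Oplus>\<^bsub>S\<^esub>i\<in>{..deg R p}. c i \<otimes>\<^bsub>S\<^esub> q i \<oplus>\<^bsub>S\<^esub> k \<otimes>\<^bsub>S\<^esub> (c i \<otimes>\<^bsub>S\<^esub> D i) \<oplus>\<^bsub>S\<^esub> k \<otimes>\<^bsub>S\<^esub> k \<otimes>\<^bsub>S\<^esub> (c i \<otimes>\<^bsub>S\<^esub> r i))"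
  proof (rule S.finsum_cong')
    fix i
    show "c i \<otimes>\<^bsub>S\<^esub> (q i \<oplus>\<^bsub>S\<^esub> k \<otimes>\<^bsub>S\<^esub> D i \<oplus>\<^bsub>S\<^esub> k \<otimes>\<^bsub>S\<^esub> k \<otimes>\<^bsub>S\<^esub> r i) =
      c i \<otimes>\<^bsub>S\<^esub> q i \<oplus>\<^bsub>S\<^esub> k \<otimes>\<^bsub>S\<^esub> (c i \<otimes>\<^bsub>S\<^esub> D i) \<oplus>\<^bsub>S\<^esub> k \<otimes>\<^bsub>S\<^esub> k \<otimes>\<^bsub>S\<^esub> (c i \<otimes>\<^bsub>S\<^esub> r i)"
      using c[of i] q[of i] D[of i] r[of i] k by algebra
  qed (auto simp: c q D r k)
  also have "\<dots> = (\<Oplus>\<^bsub>S\<^esub>i\<in>{..deg R p}. c i \<otimes>\<^bsub>S\<^esub> q i) \<oplus>\<^bsub>S\<^esub> k \<otimes>\<^bsub>S\<^esub> (\<Oplus>\<^bsub>S\<^esub>i\<in>{..deg R p}. c i \<otimes>\<^bsub>S\<^esub> D i)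
     \<oplus>\<^bsub>S\<^esub> k \<otimes>\<^bsub>S\<^esub> k \<otimes>\<^bsub>S\<^esub> (\<Oplus>\<^bsub>S\<^esub>i\<in>{..deg R p}. c i \<otimes>\<^bsub>S\<^esub> r i)"
    using c q D r k by (simp add: S.finsum_addf S.finsum_rdistr Pi_def)
  also have "(\<Oplus>\<^bsub>S\<^esub>i\<in>{..deg R p}. c i \<otimes>\<^bsub>S\<^esub> D i) = eval R S h z (formal_deriv R p)"
    unfolding eval_formal_deriv[OF p z] c_def D_def ..
  also have "(\<Oplus>\<^bsub>S\<^esub>i\<in>{..deg R p}. c i \<otimes>\<^bsub>S\<^esub> q i) = eval R S h z p"
    unfolding eval_sum[OF p] c_def q_def ..
  finally show ?thesis using c r by (intro bexI) (auto simp: Pi_def)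
qed

text \<open>
  If two evaluations of the coefficients are congruent modulo \<open>k\<close>, so are the evaluations of
  polynomials. It is applied to a polynomial in \<open>Y\<close> whose coefficients change because \<open>Z\<close> does.
\<close>

lemma eval_shift_coeffs:
  assumes h': "ring_hom_cring R S h'" and s: "s \<in> carrier S" and k: "k \<in> carrier S"
    and d: "\<And>a. a \<in> carrier R \<Longrightarrow> \<exists>r\<in>carrier S. h' a = h a \<oplus>\<^bsub>S\<^esub> k \<otimes>\<^bsub>S\<^esub> r"
    and p: "p \<in> carrier (UP R)"
  shows "\<exists>r\<in>carrier S. eval R S h' s p = eval R S h s p \<oplus>\<^bsub>S\<^esub> k \<otimes>\<^bsub>S\<^esub> r"
proof -
  interpret h': ring_hom_cring R S h' by fact
  obtain r where r: "\<And>i. r i \<in> carrier S" and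
    e: "\<And>i. h' (coeff (UP R) p i) = h (coeff (UP R) p i) \<oplus>\<^bsub>S\<^esub> k \<otimes>\<^bsub>S\<^esub> r i"
    using d[OF coeff_UP_closed[OF p]] by metis
  have "eval R S h' s p = (\<Oplus>\<^bsub>S\<^esub>i\<in>{..deg R p}. h (coeff (UP R) p i) \<otimes>\<^bsub>S\<^esub> s [^]\<^bsub>S\<^esub> i \<oplus>\<^bsub>S\<^esub> k \<otimes>\<^bsub>S\<^esub> (r i \<otimes>\<^bsub>S\<^esub> s [^]\<^bsub>S\<^esub> i))"
    unfolding h'.eval_sum[OF p] e
    by (rule S.finsum_cong') (auto simp: p s k r S.l_distr S.m_assoc)
  also have "\<dots> = eval R S h s p \<oplus>\<^bsub>S\<^esub> k \<otimes>\<^bsub>S\<^esub> (\<Oplus>\<^bsub>S\<^esub>i\<in>{..deg R p}. r i \<otimes>\<^bsub>S\<^esub> s [^]\<^bsub>S\<^esub> i)"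
    unfolding eval_sum[OF p] using r s k p by (simp add: S.finsum_addf S.finsum_rdistr Pi_def)
  finally show ?thesis using r s
    by (intro bexI[of _ "\<Oplus>\<^bsub>S\<^esub>i\<in>{..deg R p}. r i \<otimes>\<^bsub>S\<^esub> s [^]\<^bsub>S\<^esub> i"]) (auto simp: Pi_def)
qed

end

section \<open>Evaluation in several variables and the generic point\<close>

text \<open>
  The arguments appear in the order in which the variables are adjoined: for the rings
  \<open>R[X,Z]\<close>, \<open>R[X,Z,Y]\<close> and \<open>R[X,Z,Y,T]\<close> of the problem this is \<open>x, z, y, t\<close>.
\<close>

definition eval2 where "eval2 A M h x z = eval (UP A) M (eval A M h x) z"
definition eval3 where "eval3 A M h x z y = eval (UP (UP A)) M (eval2 A M h x z) y"
definition eval4 where "eval4 A M h x z y t = eval (UP (UP (UP A))) M (eval3 A M h x z y) t"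

context ring_hom_cring
begin

lemma eval2_is_hom:
  "\<lbrakk>x \<in> carrier S; z \<in> carrier S\<rbrakk> \<Longrightarrow> ring_hom_cring (UP (UP R)) S (eval2 R S h x z)"
  unfolding eval2_def by (intro ring_hom_cring.eval_is_hom eval_is_hom)

lemma eval3_is_hom:
  "\<lbrakk>x \<in> carrier S; z \<in> carrier S; y \<in> carrier S\<rbrakk> \<Longrightarrow>
   ring_hom_cring (UP (UP (UP R))) S (eval3 R S h x z y)"
  unfolding eval3_def by (intro ring_hom_cring.eval_is_hom eval2_is_hom)

lemma eval4_is_hom:
  "\<lbrakk>x \<in> carrier S; z \<in> carrier S; y \<in> carrier S; t \<in> carrier S\<rbrakk> \<Longrightarrow>
   ring_hom_cring (UP (UP (UP (UP R)))) S (eval4 R S h x z y t)"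
  unfolding eval4_def by (intro ring_hom_cring.eval_is_hom eval3_is_hom)

lemma eval_closed:
  "\<lbrakk>x \<in> carrier S; p \<in> carrier (UP R)\<rbrakk> \<Longrightarrow> eval R S h x p \<in> carrier S"
  by (rule ring_hom_closed[OF ring_hom_cring.homh[OF eval_is_hom]])

lemma eval2_closed:
  "\<lbrakk>x \<in> carrier S; z \<in> carrier S; p \<in> carrier (UP (UP R))\<rbrakk> \<Longrightarrow> eval2 R S h x z p \<in> carrier S"
  by (rule ring_hom_closed[OF ring_hom_cring.homh[OF eval2_is_hom]])

lemma eval3_closed:
  "\<lbrakk>x \<in> carrier S; z \<in> carrier S; y \<in> carrier S; p \<in> carrier (UP (UP (UP R)))\<rbrakk> \<Longrightarrow>
   eval3 R S h x z y p \<in> carrier S"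
  by (rule ring_hom_closed[OF ring_hom_cring.homh[OF eval3_is_hom]])

lemma eval4_closed:
  "\<lbrakk>x \<in> carrier S; z \<in> carrier S; y \<in> carrier S; t \<in> carrier S; p \<in> carrier (UP (UP (UP (UP R))))\<rbrakk> \<Longrightarrow>
   eval4 R S h x z y t p \<in> carrier S"
  by (rule ring_hom_closed[OF ring_hom_cring.homh[OF eval4_is_hom]])

lemma eval2_cst:
  "\<lbrakk>x \<in> carrier S; z \<in> carrier S; p \<in> carrier (UP R)\<rbrakk> \<Longrightarrow>
   eval2 R S h x z (cst (UP R) p) = eval R S h x p"
  unfolding eval2_def by (rule ring_hom_cring.eval_cst[OF eval_is_hom])

lemma eval2_var:
  "\<lbrakk>x \<in> carrier S; z \<in> carrier S\<rbrakk> \<Longrightarrow> eval2 R S h x z (var (UP R)) = z"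
  unfolding eval2_def by (rule ring_hom_cring.eval_var[OF eval_is_hom])

lemma eval3_cst:
  "\<lbrakk>x \<in> carrier S; z \<in> carrier S; y \<in> carrier S; p \<in> carrier (UP (UP R))\<rbrakk> \<Longrightarrow>
   eval3 R S h x z y (cst (UP (UP R)) p) = eval2 R S h x z p"
  unfolding eval3_def by (rule ring_hom_cring.eval_cst[OF eval2_is_hom])

lemma eval3_var:
  "\<lbrakk>x \<in> carrier S; z \<in> carrier S; y \<in> carrier S\<rbrakk> \<Longrightarrow> eval3 R S h x z y (var (UP (UP R))) = y"
  unfolding eval3_def by (rule ring_hom_cring.eval_var[OF eval2_is_hom])

lemma eval4_cst:
  "\<lbrakk>x \<in> carrier S; z \<in> carrier S; y \<in> carrier S; t \<in> carrier S; p \<in> carrier (UP (UP (UP R)))\<rbrakk> \<Longrightarrow>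
   eval4 R S h x z y t (cst (UP (UP (UP R))) p) = eval3 R S h x z y p"
  unfolding eval4_def by (rule ring_hom_cring.eval_cst[OF eval3_is_hom])

lemma eval4_var:
  "\<lbrakk>x \<in> carrier S; z \<in> carrier S; y \<in> carrier S; t \<in> carrier S\<rbrakk> \<Longrightarrow>
   eval4 R S h x z y t (var (UP (UP (UP R)))) = t"
  unfolding eval4_def by (rule ring_hom_cring.eval_var[OF eval3_is_hom])

lemmas evals_cst_var = eval2_cst eval2_var eval3_cst eval3_var eval4_cst eval4_var

end

lemma hom_eval2:
  assumes "ring_hom_cring A M h" "ring_hom_cring A N k" "ring_hom_cring M N f"
    and "\<And>a. a \<in> carrier A \<Longrightarrow> f (h a) = k a"
    and "x \<in> carrier M" "z \<in> carrier M" "p \<in> carrier (UP (UP A))"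
  shows "f (eval2 A M h x z p) = eval2 A N k (f x) (f z) p"
proof -
  have x: "f x \<in> carrier N"
    using ring_hom_cring.homh[OF assms(3)] assms(5) by (rule ring_hom_closed)
  have k: "ring_hom_cring (UP A) N (eval A N k (f x))"
    by (rule ring_hom_cring.eval_is_hom[OF assms(2) x])
  have h: "ring_hom_cring (UP A) M (eval A M h x)"
    by (rule ring_hom_cring.eval_is_hom[OF assms(1) assms(5)])
  have "f (eval A M h x q) = eval A N k (f x) q" if "q \<in> carrier (UP A)" for q
    by (rule hom_eval[OF assms(1-3,5,4) that])
  from hom_eval[OF h k assms(3,6) this assms(7)] show ?thesis
    unfolding eval2_def .
qed

lemma hom_eval3:
  assumes "ring_hom_cring A M h" "ring_hom_cring A N k" "ring_hom_cring M N f"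
    and "\<And>a. a \<in> carrier A \<Longrightarrow> f (h a) = k a"
    and "x \<in> carrier M" "z \<in> carrier M" "y \<in> carrier M" "p \<in> carrier (UP (UP (UP A)))"
  shows "f (eval3 A M h x z y p) = eval3 A N k (f x) (f z) (f y) p"
proof -
  have "f x \<in> carrier N" "f z \<in> carrier N"
    using ring_hom_cring.homh[OF assms(3)] assms(5,6) by (auto intro: ring_hom_closed)
  then have k: "ring_hom_cring (UP (UP A)) N (eval2 A N k (f x) (f z))"
    by (rule ring_hom_cring.eval2_is_hom[OF assms(2)])
  have h: "ring_hom_cring (UP (UP A)) M (eval2 A M h x z)"
    by (rule ring_hom_cring.eval2_is_hom[OF assms(1) assms(5) assms(6)])
  have "f (eval2 A M h x z q) = eval2 A N k (f x) (f z) q" if "q \<in> carrier (UP (UP A))" for q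
    by (rule hom_eval2[OF assms(1-6) that])
  from hom_eval[OF h k assms(3,7) this assms(8)] show ?thesis
    unfolding eval3_def .
qed

lemma hom_eval4:
  assumes "ring_hom_cring A M h" "ring_hom_cring A N k" "ring_hom_cring M N f"
    and "\<And>a. a \<in> carrier A \<Longrightarrow> f (h a) = k a"
    and "x \<in> carrier M" "z \<in> carrier M" "y \<in> carrier M" "t \<in> carrier M"
    and "p \<in> carrier (UP (UP (UP (UP A))))"
  shows "f (eval4 A M h x z y t p) = eval4 A N k (f x) (f z) (f y) (f t) p"
proof -
  have "f x \<in> carrier N" "f z \<in> carrier N" "f y \<in> carrier N"
    using ring_hom_cring.homh[OF assms(3)] assms(5-7) by (auto intro: ring_hom_closed)
  then have k: "ring_hom_cring (UP (UP (UP A))) N (eval3 A N k (f x) (f z) (f y))"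
    by (rule ring_hom_cring.eval3_is_hom[OF assms(2)])
  have h: "ring_hom_cring (UP (UP (UP A))) M (eval3 A M h x z y)"
    by (rule ring_hom_cring.eval3_is_hom[OF assms(1) assms(5) assms(6) assms(7)])
  have "f (eval3 A M h x z y q) = eval3 A N k (f x) (f z) (f y) q" if "q \<in> carrier (UP (UP (UP A)))" for q
    by (rule hom_eval3[OF assms(1-7) that])
  from hom_eval[OF h k assms(3,8) this assms(9)] show ?thesis
    unfolding eval4_def .
qed

lemma hom_UP2_eqI:
  assumes A: "cring A" and M: "cring M"
    and f: "f \<in> ring_hom (UP (UP A)) M" and g: "g \<in> ring_hom (UP (UP A)) M"
    and c: "\<And>a. a \<in> carrier A \<Longrightarrow> f (cst (UP A) (cst A a)) = g (cst (UP A) (cst A a))"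
    and x: "f (cst (UP A) (var A)) = g (cst (UP A) (var A))"
    and z: "f (var (UP A)) = g (var (UP A))"
    and p: "p \<in> carrier (UP (UP A))"
  shows "f p = g p"
proof (rule hom_UP_eqI[OF cring_UP[OF A] M f g _ z p])
  have i: "cst (UP A) \<in> ring_hom (UP A) (UP (UP A))"
    using ring_hom_cring.homh[OF cst_is_hom[OF cring_UP[OF A]]] .
  fix a assume a: "a \<in> carrier (UP A)"
  show "f (cst (UP A) a) = g (cst (UP A) a)"
    using hom_UP_eqI[OF A M ring_hom_trans[OF i f] ring_hom_trans[OF i g] _ _ a] c x by simp
qed

lemma hom_UP3_eqI:
  assumes A: "cring A" and M: "cring M"
    and f: "f \<in> ring_hom (UP (UP (UP A))) M" and g: "g \<in> ring_hom (UP (UP (UP A))) M"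
    and c: "\<And>a. a \<in> carrier A \<Longrightarrow>
      f (cst (UP (UP A)) (cst (UP A) (cst A a))) = g (cst (UP (UP A)) (cst (UP A) (cst A a)))"
    and x: "f (cst (UP (UP A)) (cst (UP A) (var A))) = g (cst (UP (UP A)) (cst (UP A) (var A)))"
    and z: "f (cst (UP (UP A)) (var (UP A))) = g (cst (UP (UP A)) (var (UP A)))"
    and y: "f (var (UP (UP A))) = g (var (UP (UP A)))"
    and p: "p \<in> carrier (UP (UP (UP A)))"
  shows "f p = g p"
proof (rule hom_UP2_eqI[OF cring_UP[OF A] M f g _ z y p])
  have i: "(\<lambda>a. cst (UP (UP A)) (cst (UP A) a)) \<in> ring_hom (UP A) (UP (UP (UP A)))"
    using ring_hom_trans[OF ring_hom_cring.homh[OF cst_is_hom[OF cring_UP[OF A]]]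
      ring_hom_cring.homh[OF cst_is_hom[OF cring_UP[OF cring_UP[OF A]]]]]
    by (simp add: comp_def)
  fix a assume a: "a \<in> carrier (UP A)"
  show "f (cst (UP (UP A)) (cst (UP A) a)) = g (cst (UP (UP A)) (cst (UP A) a))"
    using hom_UP_eqI[OF A M ring_hom_trans[OF i f] ring_hom_trans[OF i g] _ _ a] c x by simp
qed

text \<open>
  The constants and the variables of the polynomial ring in four variables over \<open>A\<close>. The variables form a point of affine
  4-space with coordinates in this ring, the generic point: every other point is its image under an
  evaluation homomorphism (\<open>eval4_generic\<close>). An identity proved at the generic point therefore
  holds at all points.
\<close>

definition const4 where "const4 A a = cst (UP (UP (UP A))) (cst (UP (UP A)) (cst (UP A) (cst A a)))"
definition var1 where "var1 A = cst (UP (UP (UP A))) (cst (UP (UP A)) (cst (UP A) (var A)))"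
definition var2 where "var2 A = cst (UP (UP (UP A))) (cst (UP (UP A)) (var (UP A)))"
definition var3 where "var3 A = cst (UP (UP (UP A))) (var (UP (UP A)))"
definition var4 where "var4 A = var (UP (UP (UP A)))"

lemma hom_UP4_eqI:
  assumes A: "cring A" and M: "cring M"
    and f: "f \<in> ring_hom (UP (UP (UP (UP A)))) M" and g: "g \<in> ring_hom (UP (UP (UP (UP A)))) M"
    and c: "\<And>a. a \<in> carrier A \<Longrightarrow> f (const4 A a) = g (const4 A a)"
    and v: "f (var1 A) = g (var1 A)" "f (var2 A) = g (var2 A)" "f (var3 A) = g (var3 A)"
      "f (var4 A) = g (var4 A)"
    and p: "p \<in> carrier (UP (UP (UP (UP A))))"
  shows "f p = g p"
proof -
  have A3: "cring (UP (UP (UP A)))" by (intro cring_UP A)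
  have i: "cst (UP (UP (UP A))) \<in> ring_hom (UP (UP (UP A))) (UP (UP (UP (UP A))))"
    by (rule ring_hom_cring.homh[OF cst_is_hom[OF A3]])
  note v' = c[unfolded const4_def] v[unfolded var1_def var2_def var3_def var4_def]
  have "f (cst (UP (UP (UP A))) a) = g (cst (UP (UP (UP A))) a)" if "a \<in> carrier (UP (UP (UP A)))" for a
    using hom_UP3_eqI[OF A M ring_hom_trans[OF i f] ring_hom_trans[OF i g] _ _ _ _ that] v' by simp
  then show ?thesis by (rule hom_UP_eqI[OF A3 M f g _ v'(5) p])
qed

lemma const4_is_hom:
  assumes "cring A"
  shows "ring_hom_cring A (UP (UP (UP (UP A)))) (const4 A)"
proof -
  note c = ring_hom_cring.homh[OF cst_is_hom] and u = cring_UP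
  have "const4 A = cst (UP (UP (UP A))) \<circ> (cst (UP (UP A)) \<circ> (cst (UP A) \<circ> cst A))"
    by (auto simp: const4_def)
  also have "\<dots> \<in> ring_hom A (UP (UP (UP (UP A))))"
    by (rule ring_hom_trans[OF ring_hom_trans[OF ring_hom_trans[OF
      c[OF assms] c[OF u[OF assms]]] c[OF u[OF u[OF assms]]]] c[OF u[OF u[OF u[OF assms]]]]])
  finally show ?thesis by (intro ring_hom_cringI u assms)
qed

lemma vars_closed:
  assumes "cring A"
  shows "var1 A \<in> carrier (UP (UP (UP (UP A))))" "var2 A \<in> carrier (UP (UP (UP (UP A))))"
    "var3 A \<in> carrier (UP (UP (UP (UP A))))" "var4 A \<in> carrier (UP (UP (UP (UP A))))"
proof -
  interpret c0: ring_hom_cring A "UP A" "cst A" by (intro cst_is_hom cring_UP assms)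
  interpret c1: ring_hom_cring "UP A" "UP (UP A)" "cst (UP A)" by (intro cst_is_hom cring_UP assms)
  interpret c2: ring_hom_cring "UP (UP A)" "UP (UP (UP A))" "cst (UP (UP A))"
    by (intro cst_is_hom cring_UP assms)
  interpret c3: ring_hom_cring "UP (UP (UP A))" "UP (UP (UP (UP A)))" "cst (UP (UP (UP A)))"
    by (intro cst_is_hom cring_UP assms)
  show "var1 A \<in> carrier (UP (UP (UP (UP A))))" "var2 A \<in> carrier (UP (UP (UP (UP A))))"
    "var3 A \<in> carrier (UP (UP (UP (UP A))))" "var4 A \<in> carrier (UP (UP (UP (UP A))))"
    by (simp_all add: var1_def var2_def var3_def var4_def)
qed

context ring_hom_cring
begin

lemma eval4_generic:
  assumes "x \<in> carrier S" "z \<in> carrier S" "y \<in> carrier S" "t \<in> carrier S"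
  shows "a \<in> carrier R \<Longrightarrow> eval4 R S h x z y t (const4 R a) = h a"
    and "eval4 R S h x z y t (var1 R) = x"
    and "eval4 R S h x z y t (var2 R) = z"
    and "eval4 R S h x z y t (var3 R) = y"
    and "eval4 R S h x z y t (var4 R) = t"
proof -
  interpret c0: ring_hom_cring R "UP R" "cst R" by (intro cst_is_hom cring_UP R.is_cring)
  interpret c1: ring_hom_cring "UP R" "UP (UP R)" "cst (UP R)"
    by (intro cst_is_hom cring_UP R.is_cring)
  interpret c2: ring_hom_cring "UP (UP R)" "UP (UP (UP R))" "cst (UP (UP R))"
    by (intro cst_is_hom cring_UP R.is_cring)
  show "a \<in> carrier R \<Longrightarrow> eval4 R S h x z y t (const4 R a) = h a"
    "eval4 R S h x z y t (var1 R) = x" "eval4 R S h x z y t (var2 R) = z"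
    "eval4 R S h x z y t (var3 R) = y" "eval4 R S h x z y t (var4 R) = t"
    using assms
    by (simp_all add: const4_def var1_def var2_def var3_def var4_def evals_cst_var)
qed

end

lemma eval4_at_generic:
  assumes A: "cring A" and p: "p \<in> carrier (UP (UP (UP (UP A))))"
  shows "eval4 A (UP (UP (UP (UP A)))) (const4 A) (var1 A) (var2 A) (var3 A) (var4 A) p = p"
proof -
  let ?G = "UP (UP (UP (UP A)))"
  have G: "cring ?G" by (intro cring_UP A)
  interpret K: ring_hom_cring A ?G "const4 A" by (rule const4_is_hom[OF A])
  note v = vars_closed[OF A]
  have i: "(\<lambda>p. p) \<in> ring_hom ?G ?G" by (rule ring_hom_memI) auto
  show ?thesis
    by (rule hom_UP4_eqI[OF A G ring_hom_cring.homh[OF K.eval4_is_hom[OF v]] i _ _ _ _ _ p])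
       (simp_all add: K.eval4_generic[OF v])
qed

lemma eval3_at_generic:
  assumes A: "cring A" and p: "p \<in> carrier (UP (UP (UP A)))"
  shows "eval3 A (UP (UP (UP (UP A)))) (const4 A) (var1 A) (var2 A) (var3 A) p = cst (UP (UP (UP A))) p"
proof -
  interpret K: ring_hom_cring A "UP (UP (UP (UP A)))" "const4 A" by (rule const4_is_hom[OF A])
  interpret c3: ring_hom_cring "UP (UP (UP A))" "UP (UP (UP (UP A)))" "cst (UP (UP (UP A)))"
    by (intro cst_is_hom cring_UP A)
  note v = vars_closed[OF A]
  show ?thesis
    using eval4_at_generic[OF A c3.hom_closed[OF p]] unfolding K.eval4_cst[OF v p] .
qed

lemma eval2_at_generic:
  assumes A: "cring A" and p: "p \<in> carrier (UP (UP A))"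
  shows "eval2 A (UP (UP (UP (UP A)))) (const4 A) (var1 A) (var2 A) p =
    cst (UP (UP (UP A))) (cst (UP (UP A)) p)"
proof -
  interpret K: ring_hom_cring A "UP (UP (UP (UP A)))" "const4 A" by (rule const4_is_hom[OF A])
  interpret c2: ring_hom_cring "UP (UP A)" "UP (UP (UP A))" "cst (UP (UP A))"
    by (intro cst_is_hom cring_UP A)
  note v = vars_closed[OF A]
  show ?thesis
    using eval3_at_generic[OF A c2.hom_closed[OF p]] unfolding K.eval3_cst[OF v(1-3) p] .
qed

section \<open>The effect of a translation of Z on P and Q\<close>

context ring_hom_cring
begin

text \<open>
  The Taylor expansion is taken at \<open>z + n\<close> with increment \<open>- n\<close>, because the derivative that
  matters later is the one at the translated point. The quotient \<open>w\<close> agrees with it modulo \<open>n\<close>.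
\<close>

lemma eval2_translate_Z:
  assumes P: "P \<in> carrier (UP (UP R))" and x: "x \<in> carrier S" and z: "z \<in> carrier S"
    and n: "n \<in> carrier S"
  shows "\<exists>w\<in>carrier S. \<exists>r\<in>carrier S.
     eval2 R S h x (z \<oplus>\<^bsub>S\<^esub> n) P = eval2 R S h x z P \<oplus>\<^bsub>S\<^esub> n \<otimes>\<^bsub>S\<^esub> w \<and>
     w \<oplus>\<^bsub>S\<^esub> n \<otimes>\<^bsub>S\<^esub> r = eval2 R S h x (z \<oplus>\<^bsub>S\<^esub> n) (formal_deriv (UP R) P)"
proof -
  interpret E: ring_hom_cring "UP R" S "eval R S h x" by (rule eval_is_hom[OF x])
  define z' where "z' = z \<oplus>\<^bsub>S\<^esub> n"
  have z': "z' \<in> carrier S" unfolding z'_def using z n by simp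
  have zz: "z' \<oplus>\<^bsub>S\<^esub> (\<ominus>\<^bsub>S\<^esub> n) = z" unfolding z'_def using z n by algebra
  define p p' q where "p = eval2 R S h x z P" and "p' = eval2 R S h x z' P"
    and "q = eval2 R S h x z' (formal_deriv (UP R) P)"
  have c: "p \<in> carrier S" "p' \<in> carrier S" "q \<in> carrier S"
    unfolding p_def p'_def q_def using x z z' P by (auto intro!: eval2_closed)
  obtain r where r: "r \<in> carrier S" and
    e0: "eval (UP R) S (eval R S h x) (z' \<oplus>\<^bsub>S\<^esub> (\<ominus>\<^bsub>S\<^esub> n)) P =
     p' \<oplus>\<^bsub>S\<^esub> (\<ominus>\<^bsub>S\<^esub> n) \<otimes>\<^bsub>S\<^esub> q \<oplus>\<^bsub>S\<^esub> (\<ominus>\<^bsub>S\<^esub> n) \<otimes>\<^bsub>S\<^esub> (\<ominus>\<^bsub>S\<^esub> n) \<otimes>\<^bsub>S\<^esub> r"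
    unfolding p'_def q_def eval2_def using E.eval_taylor[OF P z' S.a_inv_closed[OF n]] by blast
  have e: "p = p' \<oplus>\<^bsub>S\<^esub> (\<ominus>\<^bsub>S\<^esub> n) \<otimes>\<^bsub>S\<^esub> q \<oplus>\<^bsub>S\<^esub> (\<ominus>\<^bsub>S\<^esub> n) \<otimes>\<^bsub>S\<^esub> (\<ominus>\<^bsub>S\<^esub> n) \<otimes>\<^bsub>S\<^esub> r"
    using e0 unfolding zz p_def eval2_def .
  have "p' = p \<oplus>\<^bsub>S\<^esub> n \<otimes>\<^bsub>S\<^esub> (q \<ominus>\<^bsub>S\<^esub> n \<otimes>\<^bsub>S\<^esub> r)"
    unfolding e using c r n by algebra
  moreover have "(q \<ominus>\<^bsub>S\<^esub> n \<otimes>\<^bsub>S\<^esub> r) \<oplus>\<^bsub>S\<^esub> n \<otimes>\<^bsub>S\<^esub> r = q"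
    using c r n by algebra
  moreover have "q \<ominus>\<^bsub>S\<^esub> n \<otimes>\<^bsub>S\<^esub> r \<in> carrier S"
    using c r n by simp
  ultimately have "\<exists>w\<in>carrier S. \<exists>r\<in>carrier S. p' = p \<oplus>\<^bsub>S\<^esub> n \<otimes>\<^bsub>S\<^esub> w \<and> w \<oplus>\<^bsub>S\<^esub> n \<otimes>\<^bsub>S\<^esub> r = q"
    using r by blast
  then show ?thesis unfolding p_def p'_def q_def z'_def .
qed

lemma eval3_translate_Z:
  assumes Q: "Q \<in> carrier (UP (UP (UP R)))" and x: "x \<in> carrier S" and z: "z \<in> carrier S"
    and n: "n \<in> carrier S" and y: "y \<in> carrier S"
  shows "\<exists>r\<in>carrier S. eval3 R S h x (z \<oplus>\<^bsub>S\<^esub> n) y Q = eval3 R S h x z y Q \<oplus>\<^bsub>S\<^esub> n \<otimes>\<^bsub>S\<^esub> r"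
proof -
  have zn: "z \<oplus>\<^bsub>S\<^esub> n \<in> carrier S" using z n by simp
  have "\<exists>r\<in>carrier S. eval2 R S h x (z \<oplus>\<^bsub>S\<^esub> n) a = eval2 R S h x z a \<oplus>\<^bsub>S\<^esub> n \<otimes>\<^bsub>S\<^esub> r"
    if "a \<in> carrier (UP (UP R))" for a
    using eval2_translate_Z[OF that x z n] by blast
  then show ?thesis unfolding eval3_def
    by (rule ring_hom_cring.eval_shift_coeffs[OF eval2_is_hom[OF x z] eval2_is_hom[OF x zn] y n _ Q])
qed

text \<open>
  If \<open>z\<close> moves by \<open>x^(d+j) u\<close> and \<open>y\<close> by \<open>x^j u w\<close>, then \<open>Q\<close> moves by \<open>x^j u w Q'\<close> up to multiples
  of \<open>x^(j+1) u\<close>. The hypotheses \<open>d \<ge> 1\<close> and \<open>j \<ge> 1\<close> are used here: the contribution of \<open>z\<close> is a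
  multiple of \<open>x^(d+j)\<close> and the quadratic remainder in \<open>y\<close> is a multiple of \<open>x^(2j)\<close>.
  Here \<open>w\<close> is a difference quotient of \<open>P\<close> and \<open>p\<close> its derivative; their difference is a multiple of \<open>x\<close>
  and goes into the error term.
  The factor \<open>u\<close> has to be kept, since the error term is absorbed into \<open>t\<close> as a multiple of \<open>u\<close>.
\<close>

lemma eval3_translate_ZY:
  fixes d j :: nat
  assumes Q: "Q \<in> carrier (UP (UP (UP R)))" and x: "x \<in> carrier S" and z: "z \<in> carrier S"
    and y: "y \<in> carrier S" and u: "u \<in> carrier S" and w: "w \<in> carrier S" and r: "r \<in> carrier S"
    and d: "d \<ge> 1" and j: "j \<ge> 1"
    and z': "z' = z \<oplus>\<^bsub>S\<^esub> x [^]\<^bsub>S\<^esub> d \<otimes>\<^bsub>S\<^esub> x [^]\<^bsub>S\<^esub> j \<otimes>\<^bsub>S\<^esub> u"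
    and y': "y' = y \<oplus>\<^bsub>S\<^esub> x [^]\<^bsub>S\<^esub> j \<otimes>\<^bsub>S\<^esub> u \<otimes>\<^bsub>S\<^esub> w"
    and p: "p = w \<oplus>\<^bsub>S\<^esub> x [^]\<^bsub>S\<^esub> d \<otimes>\<^bsub>S\<^esub> x [^]\<^bsub>S\<^esub> j \<otimes>\<^bsub>S\<^esub> u \<otimes>\<^bsub>S\<^esub> r"
  shows "\<exists>g\<in>carrier S. eval3 R S h x z' y' Q = eval3 R S h x z y Q \<oplus>\<^bsub>S\<^esub> x [^]\<^bsub>S\<^esub> j \<otimes>\<^bsub>S\<^esub> u \<otimes>\<^bsub>S\<^esub>
    (p \<otimes>\<^bsub>S\<^esub> eval3 R S h x z' y' (formal_deriv (UP (UP R)) Q) \<oplus>\<^bsub>S\<^esub> x \<otimes>\<^bsub>S\<^esub> g)"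
proof -
  define A B where "A = x [^]\<^bsub>S\<^esub> (d - 1)" and "B = x [^]\<^bsub>S\<^esub> (j - 1)"
  have AB: "A \<in> carrier S" "B \<in> carrier S" unfolding A_def B_def using x by auto
  have pw: "x [^]\<^bsub>S\<^esub> i = x [^]\<^bsub>S\<^esub> (i - 1) \<otimes>\<^bsub>S\<^esub> x" if "i \<ge> 1" for i :: nat
    using that S.nat_pow_Suc[of x "i - 1"] by simp
  have xd: "x [^]\<^bsub>S\<^esub> d = A \<otimes>\<^bsub>S\<^esub> x" and xj: "x [^]\<^bsub>S\<^esub> j = B \<otimes>\<^bsub>S\<^esub> x"
    unfolding A_def B_def using pw[OF d] pw[OF j] by auto
  define a b where "a = A \<otimes>\<^bsub>S\<^esub> x" and "b = B \<otimes>\<^bsub>S\<^esub> x \<otimes>\<^bsub>S\<^esub> u"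
  have ab: "a \<in> carrier S" "b \<in> carrier S" unfolding a_def b_def using AB x u by auto
  have z'n: "z' = z \<oplus>\<^bsub>S\<^esub> a \<otimes>\<^bsub>S\<^esub> b" and y'k: "y' = y \<oplus>\<^bsub>S\<^esub> b \<otimes>\<^bsub>S\<^esub> w"
    unfolding z' y' xd xj a_def b_def using AB x u w by (auto simp: S.m_assoc)
  have pe: "p = w \<oplus>\<^bsub>S\<^esub> a \<otimes>\<^bsub>S\<^esub> b \<otimes>\<^bsub>S\<^esub> r"
    unfolding p xd xj a_def b_def using AB x u w r by (auto simp: S.m_assoc)
  have abc: "a \<otimes>\<^bsub>S\<^esub> b \<in> carrier S" and bwc: "b \<otimes>\<^bsub>S\<^esub> w \<in> carrier S" using ab w by auto
  have y'c: "y' \<in> carrier S" and z'c: "z' \<in> carrier S" unfolding y'k z'n using y z abc bwc by auto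
  have yk: "y' \<oplus>\<^bsub>S\<^esub> (\<ominus>\<^bsub>S\<^esub> (b \<otimes>\<^bsub>S\<^esub> w)) = y" unfolding y'k using y bwc by algebra
  interpret E: ring_hom_cring "UP (UP R)" S "eval2 R S h x z'" by (rule eval2_is_hom[OF x z'c])
  \<comment> \<open>The move is done in two steps, \<open>q1\<close> being the value after moving only \<open>z\<close>.\<close>
  define q0 q1 q2 q' where "q0 = eval3 R S h x z y Q" and "q1 = eval3 R S h x z' y Q"
    and "q2 = eval3 R S h x z' y' Q" and "q' = eval3 R S h x z' y' (formal_deriv (UP (UP R)) Q)"
  have q': "q' \<in> carrier S" unfolding q'_def
    by (rule eval3_closed[OF x z'c y'c E.formal_deriv_closed[OF Q]])
  have c: "q0 \<in> carrier S" "q1 \<in> carrier S" "q2 \<in> carrier S"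
    unfolding q0_def q1_def q2_def using x z z'c y y'c Q by (auto intro!: eval3_closed)
  obtain r3 where r3: "r3 \<in> carrier S" and e3: "q1 = q0 \<oplus>\<^bsub>S\<^esub> a \<otimes>\<^bsub>S\<^esub> b \<otimes>\<^bsub>S\<^esub> r3"
    unfolding q0_def q1_def z'n using eval3_translate_Z[OF Q x z abc y] by blast
  obtain r2 where r2: "r2 \<in> carrier S" and
    e2: "q1 = q2 \<oplus>\<^bsub>S\<^esub> (\<ominus>\<^bsub>S\<^esub> (b \<otimes>\<^bsub>S\<^esub> w)) \<otimes>\<^bsub>S\<^esub> q' \<oplus>\<^bsub>S\<^esub> (\<ominus>\<^bsub>S\<^esub> (b \<otimes>\<^bsub>S\<^esub> w)) \<otimes>\<^bsub>S\<^esub> (\<ominus>\<^bsub>S\<^esub> (b \<otimes>\<^bsub>S\<^esub> w)) \<otimes>\<^bsub>S\<^esub> r2"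
    using E.eval_taylor[OF Q y'c S.a_inv_closed[OF bwc]]
    unfolding yk q1_def q2_def q'_def eval3_def by blast
  define g where "g = A \<otimes>\<^bsub>S\<^esub> r3 \<ominus>\<^bsub>S\<^esub> A \<otimes>\<^bsub>S\<^esub> b \<otimes>\<^bsub>S\<^esub> r \<otimes>\<^bsub>S\<^esub> q' \<ominus>\<^bsub>S\<^esub> B \<otimes>\<^bsub>S\<^esub> u \<otimes>\<^bsub>S\<^esub> w \<otimes>\<^bsub>S\<^esub> w \<otimes>\<^bsub>S\<^esub> r2"
  have g: "g \<in> carrier S" unfolding g_def using AB ab r r2 r3 x u w q' by simp
  have "x \<otimes>\<^bsub>S\<^esub> g = x \<otimes>\<^bsub>S\<^esub> (A \<otimes>\<^bsub>S\<^esub> r3) \<ominus>\<^bsub>S\<^esub> x \<otimes>\<^bsub>S\<^esub> (A \<otimes>\<^bsub>S\<^esub> b \<otimes>\<^bsub>S\<^esub> r \<otimes>\<^bsub>S\<^esub> q') \<ominus>\<^bsub>S\<^esub> x \<otimes>\<^bsub>S\<^esub> (B \<otimes>\<^bsub>S\<^esub> u \<otimes>\<^bsub>S\<^esub> w \<otimes>\<^bsub>S\<^esub> w \<otimes>\<^bsub>S\<^esub> r2)"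
    unfolding g_def using AB ab r r2 r3 x u w q'
    by (simp add: S.r_distr S.minus_eq S.r_minus)
  also have "\<dots> = a \<otimes>\<^bsub>S\<^esub> r3 \<ominus>\<^bsub>S\<^esub> a \<otimes>\<^bsub>S\<^esub> b \<otimes>\<^bsub>S\<^esub> r \<otimes>\<^bsub>S\<^esub> q' \<ominus>\<^bsub>S\<^esub> b \<otimes>\<^bsub>S\<^esub> w \<otimes>\<^bsub>S\<^esub> w \<otimes>\<^bsub>S\<^esub> r2"
    unfolding a_def b_def using AB r r2 r3 x u w q' by (simp add: S.m_ac)
  finally have xg: "x \<otimes>\<^bsub>S\<^esub> g = a \<otimes>\<^bsub>S\<^esub> r3 \<ominus>\<^bsub>S\<^esub> a \<otimes>\<^bsub>S\<^esub> b \<otimes>\<^bsub>S\<^esub> r \<otimes>\<^bsub>S\<^esub> q' \<ominus>\<^bsub>S\<^esub> b \<otimes>\<^bsub>S\<^esub> w \<otimes>\<^bsub>S\<^esub> w \<otimes>\<^bsub>S\<^esub> r2" .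
  have "p \<otimes>\<^bsub>S\<^esub> q' \<oplus>\<^bsub>S\<^esub> x \<otimes>\<^bsub>S\<^esub> g = w \<otimes>\<^bsub>S\<^esub> q' \<oplus>\<^bsub>S\<^esub> a \<otimes>\<^bsub>S\<^esub> r3 \<ominus>\<^bsub>S\<^esub> b \<otimes>\<^bsub>S\<^esub> w \<otimes>\<^bsub>S\<^esub> w \<otimes>\<^bsub>S\<^esub> r2"
    unfolding pe xg using ab w r r2 r3 q' by algebra
  then have "q0 \<oplus>\<^bsub>S\<^esub> b \<otimes>\<^bsub>S\<^esub> (p \<otimes>\<^bsub>S\<^esub> q' \<oplus>\<^bsub>S\<^esub> x \<otimes>\<^bsub>S\<^esub> g) = q1 \<oplus>\<^bsub>S\<^esub> b \<otimes>\<^bsub>S\<^esub> w \<otimes>\<^bsub>S\<^esub> q' \<ominus>\<^bsub>S\<^esub> b \<otimes>\<^bsub>S\<^esub> w \<otimes>\<^bsub>S\<^esub> (b \<otimes>\<^bsub>S\<^esub> w) \<otimes>\<^bsub>S\<^esub> r2"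
    unfolding e3 using c(1) ab w r2 r3 q' by algebra
  also have "\<dots> = q2"
    unfolding e2 using c(3) bwc q' r2 by algebra
  finally have "q2 = q0 \<oplus>\<^bsub>S\<^esub> x [^]\<^bsub>S\<^esub> j \<otimes>\<^bsub>S\<^esub> u \<otimes>\<^bsub>S\<^esub> (p \<otimes>\<^bsub>S\<^esub> q' \<oplus>\<^bsub>S\<^esub> x \<otimes>\<^bsub>S\<^esub> g)"
    unfolding b_def xj ..
  then show ?thesis using g unfolding q0_def q2_def q'_def by blast
qed

end

text \<open>
  The difference quotient of \<open>P\<close> under the translation of \<open>z\<close> must not depend on \<open>y\<close>, because the
  inverse map recovers \<open>y\<close> by subtracting \<open>x^j u\<close> times this slope from \<open>y'\<close>. So the polynomial \<open>w\<close>
  in four variables is evaluated with its last variable set to zero.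
\<close>

definition slope where
  "slope R M \<rho> w x z u = eval4 R M \<rho> x z u \<zero>\<^bsub>M\<^esub> w"

definition translate_Z where
  "translate_Z M d j x z u = z \<oplus>\<^bsub>M\<^esub> x [^]\<^bsub>M\<^esub> (d::nat) \<otimes>\<^bsub>M\<^esub> x [^]\<^bsub>M\<^esub> (j::nat) \<otimes>\<^bsub>M\<^esub> u"

definition translate_Y where
  "translate_Y R M \<rho> j w x z u y = y \<oplus>\<^bsub>M\<^esub> x [^]\<^bsub>M\<^esub> (j::nat) \<otimes>\<^bsub>M\<^esub> u \<otimes>\<^bsub>M\<^esub> slope R M \<rho> w x z u"

text \<open>
  The two identities that determine how the defining equations change, stated for arbitrary points
  so that they can be transported from the generic point (\<open>hom_translates_P\<close>, \<open>hom_translates_Q\<close>).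
\<close>

definition translates_P where
  "translates_P R M \<rho> d j P w x z u \<longleftrightarrow>
    eval2 R M \<rho> x (translate_Z M d j x z u) P =
    eval2 R M \<rho> x z P \<oplus>\<^bsub>M\<^esub> x [^]\<^bsub>M\<^esub> d \<otimes>\<^bsub>M\<^esub> x [^]\<^bsub>M\<^esub> j \<otimes>\<^bsub>M\<^esub> u \<otimes>\<^bsub>M\<^esub> slope R M \<rho> w x z u"

definition translates_Q where
  "translates_Q R M \<rho> d j Q w g c x z u y \<longleftrightarrow>
    eval3 R M \<rho> x (translate_Z M d j x z u) (translate_Y R M \<rho> j w x z u y) Q =
    eval3 R M \<rho> x z y Q \<oplus>\<^bsub>M\<^esub> x [^]\<^bsub>M\<^esub> j \<otimes>\<^bsub>M\<^esub> u \<otimes>\<^bsub>M\<^esub>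
      (eval3 R M \<rho> x (translate_Z M d j x z u) (translate_Y R M \<rho> j w x z u y) c \<oplus>\<^bsub>M\<^esub>
       x \<otimes>\<^bsub>M\<^esub> eval4 R M \<rho> x z u y g)"

lemma (in ring_hom_cring) translations_closed:
  assumes "x \<in> carrier S" "z \<in> carrier S" "u \<in> carrier S" "w \<in> carrier (UP (UP (UP (UP R))))"
  shows "slope R S h w x z u \<in> carrier S" "translate_Z S d j x z u \<in> carrier S"
    and "y \<in> carrier S \<Longrightarrow> translate_Y R S h j w x z u y \<in> carrier S"
proof -
  show s: "slope R S h w x z u \<in> carrier S"
    unfolding slope_def using assms by (intro eval4_closed) auto
  show "translate_Z S d j x z u \<in> carrier S" unfolding translate_Z_def using assms by simp
  show "y \<in> carrier S \<Longrightarrow> translate_Y R S h j w x z u y \<in> carrier S"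
    unfolding translate_Y_def using assms s by simp
qed

lemma hom_translations:
  assumes h: "ring_hom_cring A M h" and k: "ring_hom_cring A N k" and f: "ring_hom_cring M N f"
    and hk: "\<And>a. a \<in> carrier A \<Longrightarrow> f (h a) = k a"
    and x: "x \<in> carrier M" and z: "z \<in> carrier M" and u: "u \<in> carrier M"
    and w: "w \<in> carrier (UP (UP (UP (UP A))))"
  shows "f (slope A M h w x z u) = slope A N k w (f x) (f z) (f u)"
    and "f (translate_Z M d j x z u) = translate_Z N d j (f x) (f z) (f u)"
    and "y \<in> carrier M \<Longrightarrow> f (translate_Y A M h j w x z u y) = translate_Y A N k j w (f x) (f z) (f u) (f y)"
proof -
  interpret h: ring_hom_cring A M h by fact
  interpret f: ring_hom_cring M N f by fact
  note c = h.translations_closed[OF x z u w]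
  show s: "f (slope A M h w x z u) = slope A N k w (f x) (f z) (f u)"
    unfolding slope_def using hom_eval4[OF h k f hk x z u h.S.zero_closed w] by simp
  show "f (translate_Z M d j x z u) = translate_Z N d j (f x) (f z) (f u)"
    unfolding translate_Z_def using x z u by simp
  show "y \<in> carrier M \<Longrightarrow> f (translate_Y A M h j w x z u y) = translate_Y A N k j w (f x) (f z) (f u) (f y)"
    unfolding translate_Y_def using x z u c s by simp
qed

lemma hom_translates_P:
  assumes h: "ring_hom_cring A M h" and k: "ring_hom_cring A N k" and f: "ring_hom_cring M N f"
    and hk: "\<And>a. a \<in> carrier A \<Longrightarrow> f (h a) = k a"
    and x: "x \<in> carrier M" and z: "z \<in> carrier M" and u: "u \<in> carrier M"
    and w: "w \<in> carrier (UP (UP (UP (UP A))))" and P: "P \<in> carrier (UP (UP A))"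
    and s: "translates_P A M h d j P w x z u"
  shows "translates_P A N k d j P w (f x) (f z) (f u)"
proof -
  interpret h: ring_hom_cring A M h by fact
  interpret f: ring_hom_cring M N f by fact
  note c = h.translations_closed[OF x z u w]
  note n = hom_translations[OF h k f hk x z u w]
  show ?thesis
    using arg_cong[where f = f, OF s[unfolded translates_P_def]] x z u c P
    unfolding translates_P_def
    by (simp add: n(1,2)[symmetric] hom_eval2[OF h k f hk, symmetric] h.eval2_closed)
qed

lemma hom_translates_Q:
  assumes h: "ring_hom_cring A M h" and k: "ring_hom_cring A N k" and f: "ring_hom_cring M N f"
    and hk: "\<And>a. a \<in> carrier A \<Longrightarrow> f (h a) = k a"
    and x: "x \<in> carrier M" and z: "z \<in> carrier M" and u: "u \<in> carrier M" and y: "y \<in> carrier M"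
    and w: "w \<in> carrier (UP (UP (UP (UP A))))" and Q: "Q \<in> carrier (UP (UP (UP A)))"
    and g: "g \<in> carrier (UP (UP (UP (UP A))))" and c: "c \<in> carrier (UP (UP (UP A)))"
    and s: "translates_Q A M h d j Q w g c x z u y"
  shows "translates_Q A N k d j Q w g c (f x) (f z) (f u) (f y)"
proof -
  interpret h: ring_hom_cring A M h by fact
  interpret f: ring_hom_cring M N f by fact
  note cl = h.translations_closed(1,2)[OF x z u w] h.translations_closed(3)[OF x z u w y]
  note n = hom_translations(1,2)[OF h k f hk x z u w] hom_translations(3)[OF h k f hk x z u w y]
  show ?thesis
    using arg_cong[where f = f, OF s[unfolded translates_Q_def]] x z u y cl Q c g
    unfolding translates_Q_def
    by (simp add: n(2,3)[symmetric] hom_eval3[OF h k f hk, symmetric] hom_eval4[OF h k f hk, symmetric]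
      h.eval3_closed h.eval4_closed)
qed

text \<open>
  The existence statements of Taylor expansion, applied to the generic point, produce polynomials
  that serve for all points at once.
\<close>

lemma translation_polynomials_exist:
  fixes d j :: nat
  assumes R: "cring R" and P: "P \<in> carrier (UP (UP R))" and Q: "Q \<in> carrier (UP (UP (UP R)))"
    and d: "d \<ge> 1" and j: "j \<ge> 1"
    and c: "c = cst (UP (UP R)) (formal_deriv (UP R) P) \<otimes>\<^bsub>UP (UP (UP R))\<^esub> formal_deriv (UP (UP R)) Q"
  defines "G \<equiv> UP (UP (UP (UP R)))"
  shows "\<exists>w\<in>carrier G. \<exists>g\<in>carrier G.
    translates_P R G (const4 R) d j P w (var1 R) (var2 R) (var3 R) \<and>
    translates_Q R G (const4 R) d j Q w g c (var1 R) (var2 R) (var3 R) (var4 R)"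
proof -
  interpret K: ring_hom_cring R G "const4 R" unfolding G_def by (rule const4_is_hom[OF R])
  have G: "cring G" by (rule K.S.is_cring)
  define X Z U Y where V: "X = var1 R" "Z = var2 R" "U = var3 R" "Y = var4 R"
  note v = vars_closed[OF R, folded V G_def]
  define n where "n = X [^]\<^bsub>G\<^esub> d \<otimes>\<^bsub>G\<^esub> X [^]\<^bsub>G\<^esub> j \<otimes>\<^bsub>G\<^esub> U"
  have n: "n \<in> carrier G" unfolding n_def using v by simp
  obtain w r where w: "w \<in> carrier G" and r: "r \<in> carrier G"
    and ew: "eval2 R G (const4 R) X (Z \<oplus>\<^bsub>G\<^esub> n) P = eval2 R G (const4 R) X Z P \<oplus>\<^bsub>G\<^esub> n \<otimes>\<^bsub>G\<^esub> w"
    and er: "w \<oplus>\<^bsub>G\<^esub> n \<otimes>\<^bsub>G\<^esub> r = eval2 R G (const4 R) X (Z \<oplus>\<^bsub>G\<^esub> n) (formal_deriv (UP R) P)"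
    using K.eval2_translate_Z[OF P v(1,2) n] by blast
  \<comment> \<open>The quotient \<open>w\<close> may involve the fourth variable; setting that variable to zero removes it.\<close>
  define F where "F = eval4 R G (const4 R) X Z U \<zero>\<^bsub>G\<^esub>"
  interpret F: ring_hom_cring G G F
    unfolding F_def using K.eval4_is_hom[OF v(1-3) K.S.zero_closed, folded G_def] .
  have F: "F (const4 R a) = const4 R a" if "a \<in> carrier R" for a
    unfolding F_def V using K.eval4_generic(1)[OF v(1-3) K.S.zero_closed that] unfolding V .
  have FX: "F X = X" "F Z = Z" "F U = U"
    using K.eval4_generic(2-4)[OF v(1-3) K.S.zero_closed] unfolding F_def[symmetric] V[symmetric]
    by auto
  have Fn: "F n = n" unfolding n_def using v by (simp add: FX)
  have Zn: "Z \<oplus>\<^bsub>G\<^esub> n \<in> carrier G" using v n by simp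
  have P': "formal_deriv (UP R) P \<in> carrier (UP (UP R))" 
    by (rule ring_hom_cring.formal_deriv_closed[OF cst_is_hom[OF cring_UP[OF R]] P])
  have F2: "F (eval2 R G (const4 R) X (Z \<oplus>\<^bsub>G\<^esub> n) p) = eval2 R G (const4 R) X (Z \<oplus>\<^bsub>G\<^esub> n) p"
    "F (eval2 R G (const4 R) X Z p) = eval2 R G (const4 R) X Z p" if "p \<in> carrier (UP (UP R))" for p
    using hom_eval2[OF K.ring_hom_cring_axioms K.ring_hom_cring_axioms F.ring_hom_cring_axioms F v(1) Zn that]
      hom_eval2[OF K.ring_hom_cring_axioms K.ring_hom_cring_axioms F.ring_hom_cring_axioms F v(1,2) that]
      v n by (auto simp: FX Fn)
  have ew': "eval2 R G (const4 R) X (Z \<oplus>\<^bsub>G\<^esub> n) P = eval2 R G (const4 R) X Z P \<oplus>\<^bsub>G\<^esub> n \<otimes>\<^bsub>G\<^esub> F w"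
    using arg_cong[where f = F, OF ew] F2[OF P] v n w P by (simp add: Fn K.eval2_closed)
  have er': "F w \<oplus>\<^bsub>G\<^esub> n \<otimes>\<^bsub>G\<^esub> F r = eval2 R G (const4 R) X (Z \<oplus>\<^bsub>G\<^esub> n) (formal_deriv (UP R) P)"
    using arg_cong[where f = F, OF er] F2[OF P'] v n w r P' by (simp add: Fn)
  have sP: "translates_P R G (const4 R) d j P w X Z U"
    using ew' unfolding translates_P_def translate_Z_def slope_def F_def n_def .
  interpret E2: ring_hom_cring "UP (UP R)" "UP (UP (UP R))" "cst (UP (UP R))"
    by (intro cst_is_hom cring_UP R)
  have Fw: "F w \<in> carrier G" "F r \<in> carrier G" using w r by auto
  obtain g where g: "g \<in> carrier G" and
    eg: "eval3 R G (const4 R) X (Z \<oplus>\<^bsub>G\<^esub> n) (Y \<oplus>\<^bsub>G\<^esub> X [^]\<^bsub>G\<^esub> j \<otimes>\<^bsub>G\<^esub> U \<otimes>\<^bsub>G\<^esub> F w) Q =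
     eval3 R G (const4 R) X Z Y Q \<oplus>\<^bsub>G\<^esub> X [^]\<^bsub>G\<^esub> j \<otimes>\<^bsub>G\<^esub> U \<otimes>\<^bsub>G\<^esub>
      (eval2 R G (const4 R) X (Z \<oplus>\<^bsub>G\<^esub> n) (formal_deriv (UP R) P) \<otimes>\<^bsub>G\<^esub>
       eval3 R G (const4 R) X (Z \<oplus>\<^bsub>G\<^esub> n) (Y \<oplus>\<^bsub>G\<^esub> X [^]\<^bsub>G\<^esub> j \<otimes>\<^bsub>G\<^esub> U \<otimes>\<^bsub>G\<^esub> F w) (formal_deriv (UP (UP R)) Q)
       \<oplus>\<^bsub>G\<^esub> X \<otimes>\<^bsub>G\<^esub> g)"
    using K.eval3_translate_ZY[OF Q v(1,2,4,3) Fw d j arg_cong[where f = "\<lambda>n. Z \<oplus>\<^bsub>G\<^esub> n", OF n_def] refl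
      er'[symmetric, unfolded n_def]] unfolding n_def[symmetric] by blast
  have Y': "Y \<oplus>\<^bsub>G\<^esub> X [^]\<^bsub>G\<^esub> j \<otimes>\<^bsub>G\<^esub> U \<otimes>\<^bsub>G\<^esub> F w \<in> carrier G" using v Fw by simp
  interpret E3: ring_hom_cring "UP (UP (UP R))" G
    "eval3 R G (const4 R) X (Z \<oplus>\<^bsub>G\<^esub> n) (Y \<oplus>\<^bsub>G\<^esub> X [^]\<^bsub>G\<^esub> j \<otimes>\<^bsub>G\<^esub> U \<otimes>\<^bsub>G\<^esub> F w)"
    by (rule K.eval3_is_hom[OF v(1) Zn Y'])
  have ec: "eval3 R G (const4 R) X (Z \<oplus>\<^bsub>G\<^esub> n) (Y \<oplus>\<^bsub>G\<^esub> X [^]\<^bsub>G\<^esub> j \<otimes>\<^bsub>G\<^esub> U \<otimes>\<^bsub>G\<^esub> F w) c =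
    eval2 R G (const4 R) X (Z \<oplus>\<^bsub>G\<^esub> n) (formal_deriv (UP R) P) \<otimes>\<^bsub>G\<^esub>
       eval3 R G (const4 R) X (Z \<oplus>\<^bsub>G\<^esub> n) (Y \<oplus>\<^bsub>G\<^esub> X [^]\<^bsub>G\<^esub> j \<otimes>\<^bsub>G\<^esub> U \<otimes>\<^bsub>G\<^esub> F w) (formal_deriv (UP (UP R)) Q)"
    unfolding c E3.hom_mult[OF E2.hom_closed[OF P'] E2.formal_deriv_closed[OF Q]]
      K.eval3_cst[OF v(1) Zn Y' P'] ..
  have "translates_Q R G (const4 R) d j Q w g c X Z U Y"
    using eg unfolding translates_Q_def translate_Z_def translate_Y_def slope_def F_def[symmetric]
      n_def[symmetric] ec eval4_at_generic[OF R g[unfolded G_def], folded G_def V] .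
  then show ?thesis using sP w g unfolding V by blast
qed

section \<open>Points of the algebras and of their cylinders\<close>

lemma FactRing_coset: "c \<in> carrier (G Quot I) \<Longrightarrow> \<exists>p\<in>carrier G. c = I +>\<^bsub>G\<^esub> p"
  by (simp add: FactRing_def A_RCOSETS_def')

text \<open>
  \<open>F\<close> is constant on the cosets of \<open>I\<close>, so the value of \<open>f\<close> at a coset is the only element of its
  image.
\<close>

lemma factor_through_quotient:
  assumes I: "ideal I G" and G: "cring G" and F: "ring_hom_cring G M F"
    and k: "\<And>p. p \<in> I \<Longrightarrow> F p = \<zero>\<^bsub>M\<^esub>"
  shows "\<exists>f\<in>ring_hom (G Quot I) M. \<forall>p\<in>carrier G. f (I +>\<^bsub>G\<^esub> p) = F p"
proof -
  interpret G: cring G by fact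
  interpret I: ideal I G by fact
  interpret F: ring_hom_cring G M F by fact
  interpret \<pi>: ring_hom_ring G "G Quot I" "(+>\<^bsub>G\<^esub>) I" by (rule I.rcos_ring_hom_ring)
  define f where "f c = the_elem (F ` c)" for c
  have f: "f (I +>\<^bsub>G\<^esub> p) = F p" if p: "p \<in> carrier G" for p
  proof -
    have "F ` (I +>\<^bsub>G\<^esub> p) = {F p}"
    proof
      show "F ` (I +>\<^bsub>G\<^esub> p) \<subseteq> {F p}"
        using p k I.Icarr by (auto simp: a_r_coset_def r_coset_def)
      show "{F p} \<subseteq> F ` (I +>\<^bsub>G\<^esub> p)"
        using I.a_rcos_self[OF p] by auto
    qed
    then show ?thesis unfolding f_def by simp
  qed
  have "f \<in> ring_hom (G Quot I) M"
  proof (rule ring_hom_memI)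
    fix c assume "c \<in> carrier (G Quot I)"
    then obtain p where "p \<in> carrier G" "c = I +>\<^bsub>G\<^esub> p" using FactRing_coset[of c G I] by auto
    then show "f c \<in> carrier M" by (simp add: f)
  next
    fix c c' assume "c \<in> carrier (G Quot I)" "c' \<in> carrier (G Quot I)"
    then obtain p p' where p: "p \<in> carrier G" "p' \<in> carrier G"
      and c: "c = I +>\<^bsub>G\<^esub> p" "c' = I +>\<^bsub>G\<^esub> p'"
      using FactRing_coset[of c G I] FactRing_coset[of c' G I] by auto
    show "f (c \<otimes>\<^bsub>G Quot I\<^esub> c') = f c \<otimes>\<^bsub>M\<^esub> f c'"
      unfolding c using \<pi>.hom_mult[OF p] f p F.hom_mult[OF p] G.m_closed[OF p] by metis
    show "f (c \<oplus>\<^bsub>G Quot I\<^esub> c') = f c \<oplus>\<^bsub>M\<^esub> f c'"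
      unfolding c using \<pi>.hom_add[OF p] f p F.hom_add[OF p] G.add.m_closed[OF p] by metis
  next
    show "f \<one>\<^bsub>G Quot I\<^esub> = \<one>\<^bsub>M\<^esub>"
      using \<pi>.hom_one f G.one_closed F.hom_one by metis
  qed
  then show ?thesis using f by blast
qed

text \<open>
  The points of \<open>Spec B_j\<close> with coordinates in the \<open>R\<close>-algebra \<open>M\<close>, whose structure map is \<open>\<rho>\<close>.
\<close>

definition is_point where
  "is_point R M \<rho> d j P Q x z y t \<longleftrightarrow>
    x \<in> carrier M \<and> z \<in> carrier M \<and> y \<in> carrier M \<and> t \<in> carrier M \<and>
    x [^]\<^bsub>M\<^esub> (d::nat) \<otimes>\<^bsub>M\<^esub> y = eval2 R M \<rho> x z P \<and>
    x [^]\<^bsub>M\<^esub> (j::nat) \<otimes>\<^bsub>M\<^esub> t = eval3 R M \<rho> x z y Q"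

lemma rel1_eq:
  "rel1 R d P = var1 R [^]\<^bsub>UP (UP (UP (UP R)))\<^esub> d \<otimes>\<^bsub>UP (UP (UP (UP R)))\<^esub> var3 R
     \<ominus>\<^bsub>UP (UP (UP (UP R)))\<^esub> cst (UP (UP (UP R))) (cst (UP (UP R)) P)"
  by (simp add: rel1_def Let_def var1_def var3_def)

lemma rel2_eq:
  "rel2 R j Q = var1 R [^]\<^bsub>UP (UP (UP (UP R)))\<^esub> j \<otimes>\<^bsub>UP (UP (UP (UP R)))\<^esub> var4 R
     \<ominus>\<^bsub>UP (UP (UP (UP R)))\<^esub> cst (UP (UP (UP R))) Q"
  by (simp add: rel2_def Let_def var1_def var4_def)

locale B_algebra =
  fixes R :: "('a, 'm) ring_scheme" (structure) and d j :: nat and P Q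
  assumes cring_R: "cring R"
    and P_closed: "P \<in> carrier (UP (UP R))"
    and Q_closed: "Q \<in> carrier (UP (UP (UP R)))"
begin

abbreviation G where "G \<equiv> UP (UP (UP (UP R)))"
abbreviation B where "B \<equiv> B_ring R d j P Q"
definition proj where "proj p = B_ideal R d j P Q +>\<^bsub>G\<^esub> p"

lemma cring_G: "cring G" by (intro cring_UP cring_R)

lemma PQ_closed:
  "cst (UP (UP (UP R))) (cst (UP (UP R)) P) \<in> carrier G"
  "cst (UP (UP (UP R))) Q \<in> carrier G"
proof -
  interpret c2: ring_hom_cring "UP (UP R)" "UP (UP (UP R))" "cst (UP (UP R))"
    by (intro cst_is_hom cring_UP cring_R)
  interpret c3: ring_hom_cring "UP (UP (UP R))" G "cst (UP (UP (UP R)))"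
    by (intro cst_is_hom cring_UP cring_R)
  show "cst (UP (UP (UP R))) (cst (UP (UP R)) P) \<in> carrier G"
    "cst (UP (UP (UP R))) Q \<in> carrier G"
    using P_closed Q_closed by simp_all
qed

lemma rels_closed: "rel1 R d P \<in> carrier G" "rel2 R j Q \<in> carrier G"
proof -
  interpret G: cring G by (rule cring_G)
  show "rel1 R d P \<in> carrier G" "rel2 R j Q \<in> carrier G"
    unfolding rel1_eq rel2_eq using vars_closed[OF cring_R] PQ_closed by simp_all
qed

lemma ideal_B: "ideal (B_ideal R d j P Q) G"
proof -
  interpret G: cring G by (rule cring_G)
  show ?thesis unfolding B_ideal_def using rels_closed by (intro G.genideal_ideal) auto
qed

lemma proj_is_hom: "ring_hom_cring G B proj"
proof -
  have "proj = (+>\<^bsub>G\<^esub>) (B_ideal R d j P Q)" by (auto simp: proj_def)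
  then show ?thesis unfolding B_ring_def
    using ideal.rcos_ring_hom_cring[OF ideal_B cring_G] by simp
qed

lemma cring_B: "cring B"
  using proj_is_hom by (auto simp: ring_hom_cring_def)

lemma proj_surj: "c \<in> carrier B \<Longrightarrow> \<exists>p\<in>carrier G. c = proj p"
  unfolding B_ring_def proj_def by (rule FactRing_coset)

lemma proj_zero: "p \<in> B_ideal R d j P Q \<Longrightarrow> proj p = \<zero>\<^bsub>B\<^esub>"
proof -
  interpret I: ideal "B_ideal R d j P Q" G by (rule ideal_B)
  show "p \<in> B_ideal R d j P Q \<Longrightarrow> proj p = \<zero>\<^bsub>B\<^esub>"
    unfolding proj_def B_ring_def by (simp add: FactRing_def I.a_rcos_const)
qed

lemma proj_rels:
  "proj (var1 R) [^]\<^bsub>B\<^esub> d \<otimes>\<^bsub>B\<^esub> proj (var3 R) = proj (cst (UP (UP (UP R))) (cst (UP (UP R)) P))"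
  "proj (var1 R) [^]\<^bsub>B\<^esub> j \<otimes>\<^bsub>B\<^esub> proj (var4 R) = proj (cst (UP (UP (UP R))) Q)"
proof -
  interpret \<pi>: ring_hom_cring G B proj by (rule proj_is_hom)
  have "rel1 R d P \<in> B_ideal R d j P Q" "rel2 R j Q \<in> B_ideal R d j P Q"
    unfolding B_ideal_def using \<pi>.R.genideal_self[of "{rel1 R d P, rel2 R j Q}"] rels_closed by auto
  then have "proj (rel1 R d P) = \<zero>\<^bsub>B\<^esub>" "proj (rel2 R j Q) = \<zero>\<^bsub>B\<^esub>"
    using proj_zero by blast+
  then show
    "proj (var1 R) [^]\<^bsub>B\<^esub> d \<otimes>\<^bsub>B\<^esub> proj (var3 R) = proj (cst (UP (UP (UP R))) (cst (UP (UP R)) P))"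
    "proj (var1 R) [^]\<^bsub>B\<^esub> j \<otimes>\<^bsub>B\<^esub> proj (var4 R) = proj (cst (UP (UP (UP R))) Q)"
    using vars_closed[OF cring_R] PQ_closed unfolding rel1_eq rel2_eq
    by (simp_all add: ring_hom_cring.hom_sub[OF proj_is_hom] ring.r_right_minus_eq[OF cring.axioms(1)[OF cring_B]])
qed

text \<open>
  The universal property of \<open>B_j\<close>: evaluation at a point kills both relations.
\<close>

lemma hom_from_B:
  assumes \<rho>: "ring_hom_cring R M \<rho>" and pt: "is_point R M \<rho> d j P Q x z y t"
  shows "\<exists>f\<in>ring_hom B M. \<forall>p\<in>carrier G. f (proj p) = eval4 R M \<rho> x z y t p"
proof -
  interpret \<rho>: ring_hom_cring R M \<rho> by fact
  define F where "F = eval4 R M \<rho> x z y t"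
  have c: "x \<in> carrier M" "z \<in> carrier M" "y \<in> carrier M" "t \<in> carrier M"
    using pt by (auto simp: is_point_def)
  interpret F: ring_hom_cring G M F unfolding F_def by (rule \<rho>.eval4_is_hom[OF c])
  interpret c2: ring_hom_cring "UP (UP R)" "UP (UP (UP R))" "cst (UP (UP R))"
    by (intro cst_is_hom cring_UP cring_R)
  have FP: "F (cst (UP (UP (UP R))) (cst (UP (UP R)) P)) = eval2 R M \<rho> x z P"
    "F (cst (UP (UP (UP R))) Q) = eval3 R M \<rho> x z y Q"
    unfolding F_def using c P_closed Q_closed by (simp_all add: \<rho>.evals_cst_var)
  have FX: "F (var1 R) = x" "F (var3 R) = y" "F (var4 R) = t"
    unfolding F_def using \<rho>.eval4_generic[OF c] by auto
  have "F (rel1 R d P) = x [^]\<^bsub>M\<^esub> d \<otimes>\<^bsub>M\<^esub> y \<ominus>\<^bsub>M\<^esub> eval2 R M \<rho> x z P"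
    "F (rel2 R j Q) = x [^]\<^bsub>M\<^esub> j \<otimes>\<^bsub>M\<^esub> t \<ominus>\<^bsub>M\<^esub> eval3 R M \<rho> x z y Q"
    unfolding rel1_eq rel2_eq using PQ_closed vars_closed[OF cring_R]
    by (simp_all add: ring_hom_cring.hom_sub[OF F.ring_hom_cring_axioms] FP FX)
  then have z: "F (rel1 R d P) = \<zero>\<^bsub>M\<^esub>" "F (rel2 R j Q) = \<zero>\<^bsub>M\<^esub>"
    using pt c \<rho>.eval2_closed[OF c(1,2) P_closed] \<rho>.eval3_closed[OF c(1-3) Q_closed]
    unfolding is_point_def by (simp_all add: ring.r_right_minus_eq[OF cring.axioms(1)[OF \<rho>.S.is_cring]])
  have "{rel1 R d P, rel2 R j Q} \<subseteq> a_kernel G M F"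
    using rels_closed z unfolding a_kernel_def' by blast
  then have "B_ideal R d j P Q \<subseteq> a_kernel G M F"
    unfolding B_ideal_def by (rule F.R.genideal_minimal[OF F.ring.kernel_is_ideal])
  then have "\<And>p. p \<in> B_ideal R d j P Q \<Longrightarrow> F p = \<zero>\<^bsub>M\<^esub>"
    unfolding a_kernel_def' by blast
  from factor_through_quotient[OF ideal_B cring_G F.ring_hom_cring_axioms this]
  show ?thesis unfolding F_def B_ring_def proj_def .
qed

end

definition cylinder_points where
  "cylinder_points R M \<rho> d j P Q =
    {(x, z, y, t, u). is_point R M \<rho> d j P Q x z y t \<and> u \<in> carrier M}"

definition map5 where "map5 f = (\<lambda>(x, z, y, t, u). (f x, f z, f y, f t, f u))"

context B_algebra
begin

definition to_cylinder where "to_cylinder p = cst B (proj p)"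

definition generic_point where
  "generic_point = (to_cylinder (var1 R), to_cylinder (var2 R), to_cylinder (var3 R), to_cylinder (var4 R), var B)"

lemma to_cylinder_is_hom: "ring_hom_cring G (UP B) to_cylinder"
proof -
  interpret \<pi>: ring_hom_cring G B proj by (rule proj_is_hom)
  interpret c: ring_hom_cring B "UP B" "cst B" by (rule cst_is_hom[OF cring_B])
  show ?thesis
    by (intro ring_hom_cringI cring_G cring_UP cring_B ring_hom_memI) (simp_all add: to_cylinder_def)
qed

lemma structure_map_is_hom: "ring_hom_cring R (UP B) (\<lambda>r. to_cylinder (const4 R r))"
proof -
  interpret e: ring_hom_cring G "UP B" to_cylinder by (rule to_cylinder_is_hom)
  interpret k: ring_hom_cring R G "const4 R" by (rule const4_is_hom[OF cring_R])
  show ?thesis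
    by (intro ring_hom_cringI cring_R cring_UP cring_B ring_hom_memI) simp_all
qed

lemma generic_point_in: "generic_point \<in> cylinder_points R (UP B) (\<lambda>r. to_cylinder (const4 R r)) d j P Q"
proof -
  interpret \<pi>: ring_hom_cring G B proj by (rule proj_is_hom)
  interpret e: ring_hom_cring G "UP B" to_cylinder by (rule to_cylinder_is_hom)
  interpret c: ring_hom_cring B "UP B" "cst B" by (rule cst_is_hom[OF cring_B])
  note v = vars_closed[OF cring_R]
  note n = const4_is_hom[OF cring_R] structure_map_is_hom e.ring_hom_cring_axioms refl v(1,2)
  have P: "eval2 R (UP B) (\<lambda>r. to_cylinder (const4 R r)) (to_cylinder (var1 R)) (to_cylinder (var2 R)) P =
    to_cylinder (cst (UP (UP (UP R))) (cst (UP (UP R)) P))"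
    unfolding eval2_at_generic[OF cring_R P_closed, symmetric]
    by (rule hom_eval2[OF n P_closed, symmetric])
  have Q: "eval3 R (UP B) (\<lambda>r. to_cylinder (const4 R r)) (to_cylinder (var1 R)) (to_cylinder (var2 R)) (to_cylinder (var3 R)) Q =
    to_cylinder (cst (UP (UP (UP R))) Q)"
    unfolding eval3_at_generic[OF cring_R Q_closed, symmetric]
    by (rule hom_eval3[OF n v(3) Q_closed, symmetric])
  have "is_point R (UP B) (\<lambda>r. to_cylinder (const4 R r)) d j P Q
    (to_cylinder (var1 R)) (to_cylinder (var2 R)) (to_cylinder (var3 R)) (to_cylinder (var4 R))"
    unfolding is_point_def P Q
    using v arg_cong[where f = "cst B", OF proj_rels(1)] arg_cong[where f = "cst B", OF proj_rels(2)]
    by (simp add: to_cylinder_def)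
  then show ?thesis unfolding cylinder_points_def generic_point_def by simp
qed

text \<open>
  With \<open>cylinder_hom_eqI\<close> this says that the cylinder \<open>B_j[V]\<close> represents the functor of
  cylinder points, with \<open>generic_point\<close> as the universal one.
\<close>

lemma hom_from_cylinder:
  assumes \<rho>: "ring_hom_cring R M \<rho>" and \<tau>: "\<tau> \<in> cylinder_points R M \<rho> d j P Q"
  shows "\<exists>f. ring_hom_cring (UP B) M f \<and> (\<forall>r\<in>carrier R. f (to_cylinder (const4 R r)) = \<rho> r) \<and>
    map5 f generic_point = \<tau>"
proof -
  interpret \<rho>: ring_hom_cring R M \<rho> by fact
  interpret \<pi>: ring_hom_cring G B proj by (rule proj_is_hom)
  obtain x z y t u where \<tau>_eq: "\<tau> = (x, z, y, t, u)" by (cases \<tau>)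
  have pt: "is_point R M \<rho> d j P Q x z y t" and u: "u \<in> carrier M"
    using \<tau> unfolding \<tau>_eq cylinder_points_def by auto
  have c: "x \<in> carrier M" "z \<in> carrier M" "y \<in> carrier M" "t \<in> carrier M"
    using pt by (auto simp: is_point_def)
  obtain f0 where f0: "f0 \<in> ring_hom B M"
    and f0p: "\<And>p. p \<in> carrier G \<Longrightarrow> f0 (proj p) = eval4 R M \<rho> x z y t p"
    using hom_from_B[OF \<rho> pt] by blast
  interpret f0: ring_hom_cring B M f0 by (intro ring_hom_cringI cring_B \<rho>.S.is_cring f0)
  interpret f: ring_hom_cring "UP B" M "eval B M f0 u" by (rule f0.eval_is_hom[OF u])
  have e: "eval B M f0 u (to_cylinder p) = eval4 R M \<rho> x z y t p" if "p \<in> carrier G" for p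
    unfolding to_cylinder_def using u that f0p by simp
  interpret k: ring_hom_cring R G "const4 R" by (rule const4_is_hom[OF cring_R])
  show ?thesis
    using f.ring_hom_cring_axioms e vars_closed[OF cring_R] \<rho>.eval4_generic[OF c] u
    unfolding map5_def generic_point_def \<tau>_eq
    by (intro exI[of _ "eval B M f0 u"]) simp
qed

lemma cylinder_hom_eqI:
  assumes f: "ring_hom_cring (UP B) M f" and g: "ring_hom_cring (UP B) M g"
    and \<rho>: "\<And>r. r \<in> carrier R \<Longrightarrow> f (to_cylinder (const4 R r)) = g (to_cylinder (const4 R r))"
    and \<tau>: "map5 f generic_point = map5 g generic_point"
    and c: "c \<in> carrier (UP B)"
  shows "f c = g c"
proof -
  interpret f: ring_hom_cring "UP B" M f by fact
  interpret g: ring_hom_cring "UP B" M g by fact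
  have v: "f (to_cylinder (var1 R)) = g (to_cylinder (var1 R))" "f (to_cylinder (var2 R)) = g (to_cylinder (var2 R))"
    "f (to_cylinder (var3 R)) = g (to_cylinder (var3 R))" "f (to_cylinder (var4 R)) = g (to_cylinder (var4 R))" "f (var B) = g (var B)"
    using \<tau> by (auto simp: map5_def generic_point_def)
  note e = ring_hom_cring.homh[OF to_cylinder_is_hom]
  have fe: "(f \<circ> to_cylinder) p = (g \<circ> to_cylinder) p" if p: "p \<in> carrier G" for p
    by (rule hom_UP4_eqI[OF cring_R f.S.is_cring ring_hom_trans[OF e f.homh] ring_hom_trans[OF e g.homh] _ _ _ _ _ p])
       (simp_all add: \<rho> v)
  show ?thesis
  proof (rule hom_UP_eqI[OF cring_B f.S.is_cring f.homh g.homh _ v(5) c])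
    fix b assume "b \<in> carrier B"
    then obtain p where "p \<in> carrier G" "b = proj p" using proj_surj by blast
    then show "f (cst B b) = g (cst B b)" using fe by (simp add: to_cylinder_def)
  qed
qed

end

section \<open>A Bezout relation from the unit ideal hypotheses\<close>

text \<open>
  This is what lifts a relation from \<open>B\<close> to \<open>A\<close> up to a multiple of \<open>x\<close>: elements of \<open>B\<close> have lifts, and
  two lifts of the same element differ by a multiple of \<open>x\<close>.
\<close>

definition reduces_mod where
  "reduces_mod A B h x \<longleftrightarrow> ring_hom_cring A B h \<and> x \<in> carrier A \<and>
    (\<forall>b\<in>carrier B. \<exists>a\<in>carrier A. h a = b) \<and>
    (\<forall>a\<in>carrier A. h a = \<zero>\<^bsub>B\<^esub> \<longrightarrow> (\<exists>q\<in>carrier A. a = x \<otimes>\<^bsub>A\<^esub> q))"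

lemma cst_mult_var_pow:
  assumes A: "cring A" and a: "a \<in> carrier A"
  shows "cst A a \<otimes>\<^bsub>UP A\<^esub> var A [^]\<^bsub>UP A\<^esub> (n::nat) = monom (UP A) a n"
proof -
  interpret U: UP_cring A "UP A" by (intro UP_cring.intro A) simp
  have "monom (UP A) (a \<otimes>\<^bsub>A\<^esub> \<one>\<^bsub>A\<^esub>) (0 + n) = monom (UP A) a 0 \<otimes>\<^bsub>UP A\<^esub> monom (UP A) \<one>\<^bsub>A\<^esub> n"
    using a by (intro U.monom_mult) auto
  then show ?thesis unfolding cst_def var_def using a
    by (simp add: U.monom_pow del: U.monom_mult)
qed

context ring_hom_cring begin

lemma map_coeffs_is_hom: "ring_hom_cring (UP R) (UP S) (map_coeffs R S h)"
  and map_coeffs_sum: "p \<in> carrier (UP R) \<Longrightarrow>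
    map_coeffs R S h p = (\<Oplus>\<^bsub>UP S\<^esub>i\<in>{..deg R p}. monom (UP S) (h (coeff (UP R) p i)) i)"
  and map_coeffs_cst: "a \<in> carrier R \<Longrightarrow> map_coeffs R S h (cst R a) = cst S (h a)"
  and map_coeffs_var: "map_coeffs R S h (var R) = var S"
proof -
  interpret c: ring_hom_cring S "UP S" "cst S" by (rule cst_is_hom[OF S.is_cring])
  have "(\<lambda>a. cst S (h a)) \<in> ring_hom R (UP S)" by (auto intro!: ring_hom_memI)
  then interpret ch: ring_hom_cring R "UP S" "\<lambda>a. cst S (h a)"
    by (intro ring_hom_cringI R.is_cring cring_UP S.is_cring)
  show "ring_hom_cring (UP R) (UP S) (map_coeffs R S h)"
    unfolding map_coeffs_def by (rule ch.eval_is_hom[OF c.var_closed])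
  show "map_coeffs R S h p = (\<Oplus>\<^bsub>UP S\<^esub>i\<in>{..deg R p}. monom (UP S) (h (coeff (UP R) p i)) i)"
    if p: "p \<in> carrier (UP R)"
    unfolding map_coeffs_def ch.eval_sum[OF p]
    using cst_mult_var_pow[OF S.is_cring hom_closed[OF coeff_UP_closed[OF p]]] by simp
  show "map_coeffs R S h (var R) = var S" unfolding map_coeffs_def by simp
  show "a \<in> carrier R \<Longrightarrow> map_coeffs R S h (cst R a) = cst S (h a)"
    unfolding map_coeffs_def by simp
qed

lemma coeff_map_coeffs:
  assumes p: "p \<in> carrier (UP R)"
  shows "coeff (UP S) (map_coeffs R S h p) k = h (coeff (UP R) p k)"
proof -
  interpret U: UP_cring S "UP S" by (intro UP_cring.intro S.is_cring) simp
  interpret V: UP_cring R "UP R" by (intro UP_cring.intro R.is_cring) simp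
  have "coeff (UP S) (map_coeffs R S h p) k =
    (\<Oplus>\<^bsub>S\<^esub>i\<in>{..deg R p}. coeff (UP S) (monom (UP S) (h (coeff (UP R) p i)) i) k)"
    unfolding map_coeffs_sum[OF p] using p by (subst U.coeff_finsum) auto
  also have "\<dots> = (\<Oplus>\<^bsub>S\<^esub>i\<in>{..deg R p}. if k = i then h (coeff (UP R) p i) else \<zero>\<^bsub>S\<^esub>)"
    using p by (intro S.finsum_cong') auto
  also have "\<dots> = h (coeff (UP R) p k)"
  proof (cases "k \<le> deg R p")
    case True
    then show ?thesis using p S.finsum_singleton[of k "{..deg R p}" "\<lambda>i. h (coeff (UP R) p i)"] by auto
  next
    case False
    then have "(\<Oplus>\<^bsub>S\<^esub>i\<in>{..deg R p}. if k = i then h (coeff (UP R) p i) else \<zero>\<^bsub>S\<^esub>) = (\<Oplus>\<^bsub>S\<^esub>i\<in>{..deg R p}. \<zero>\<^bsub>S\<^esub>)"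
      by (intro S.finsum_cong') auto
    then show ?thesis using False V.deg_aboveD[OF _ p, of k] by simp
  qed
  finally show ?thesis .
qed

end

text \<open>
  Both halves are checked coefficientwise. Starting from \<open>reduces_mod_subst0_X\<close> and applied twice,
  this covers the substitutions \<open>X = 0\<close> in \<open>R[X,Z]\<close> and \<open>R[X,Y,Z]\<close>.
\<close>

lemma reduces_mod_map_coeffs:
  assumes "reduces_mod A B h x"
  shows "reduces_mod (UP A) (UP B) (map_coeffs A B h) (cst A x)"
proof -
  from assms have h: "ring_hom_cring A B h" and x: "x \<in> carrier A"
    and surj: "\<And>b. b \<in> carrier B \<Longrightarrow> \<exists>a\<in>carrier A. h a = b"
    and ker: "\<And>a. a \<in> carrier A \<Longrightarrow> h a = \<zero>\<^bsub>B\<^esub> \<Longrightarrow> \<exists>q\<in>carrier A. a = x \<otimes>\<^bsub>A\<^esub> q"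
    by (auto simp: reduces_mod_def)
  interpret h: ring_hom_cring A B h by fact
  interpret U: UP_cring A "UP A" by (intro UP_cring.intro h.R.is_cring) simp
  interpret V: UP_cring B "UP B" by (intro UP_cring.intro h.S.is_cring) simp
  interpret m: ring_hom_cring "UP A" "UP B" "map_coeffs A B h" by (rule h.map_coeffs_is_hom)
  interpret c: ring_hom_cring A "UP A" "cst A" by (rule cst_is_hom[OF h.R.is_cring])
  have "\<exists>p\<in>carrier (UP A). map_coeffs A B h p = q" if q: "q \<in> carrier (UP B)" for q
  proof -
    have "\<forall>i. \<exists>a\<in>carrier A. h a = coeff (UP B) q i"
      using surj V.coeff_closed[OF q] by blast
    then obtain a where a: "\<And>i. a i \<in> carrier A" and ha: "\<And>i. h (a i) = coeff (UP B) q i" by metis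
    have ma: "map_coeffs A B h (monom (UP A) (a i) i) = monom (UP B) (coeff (UP B) q i) i" for i
      unfolding cst_mult_var_pow[OF h.R.is_cring a, symmetric]
        cst_mult_var_pow[OF h.S.is_cring V.coeff_closed[OF q], symmetric]
      using a by (simp add: h.map_coeffs_cst h.map_coeffs_var ha)
    have "map_coeffs A B h (\<Oplus>\<^bsub>UP A\<^esub>i\<in>{..deg B q}. monom (UP A) (a i) i) =
      (\<Oplus>\<^bsub>UP B\<^esub>i\<in>{..deg B q}. monom (UP B) (coeff (UP B) q i) i)"
      using a by (subst m.hom_finsum) (auto simp: ma comp_def)
    also have "\<dots> = q" by (rule V.up_repr[OF q])
    finally show ?thesis using a
      by (intro bexI[of _ "\<Oplus>\<^bsub>UP A\<^esub>i\<in>{..deg B q}. monom (UP A) (a i) i"]) (auto intro!: U.P.finsum_closed)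
  qed
  moreover have "\<exists>q\<in>carrier (UP A). p = cst A x \<otimes>\<^bsub>UP A\<^esub> q"
    if p: "p \<in> carrier (UP A)" and z: "map_coeffs A B h p = \<zero>\<^bsub>UP B\<^esub>" for p
  proof -
    have "h (coeff (UP A) p i) = \<zero>\<^bsub>B\<^esub>" for i
      using h.coeff_map_coeffs[OF p, of i] unfolding z by simp
    then have "\<forall>i. \<exists>q\<in>carrier A. coeff (UP A) p i = x \<otimes>\<^bsub>A\<^esub> q"
      using ker U.coeff_closed[OF p] by blast
    then obtain a where a: "\<And>i. a i \<in> carrier A" and ca: "\<And>i. coeff (UP A) p i = x \<otimes>\<^bsub>A\<^esub> a i" by metis
    have ma: "monom (UP A) (x \<otimes>\<^bsub>A\<^esub> a i) i = cst A x \<otimes>\<^bsub>UP A\<^esub> monom (UP A) (a i) i" for i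
      using U.monom_mult[OF x a[of i], of 0 i] unfolding cst_def by simp
    have "p = (\<Oplus>\<^bsub>UP A\<^esub>i\<in>{..deg A p}. cst A x \<otimes>\<^bsub>UP A\<^esub> monom (UP A) (a i) i)"
      using U.up_repr[OF p] unfolding ca ma ..
    also have "\<dots> = cst A x \<otimes>\<^bsub>UP A\<^esub> (\<Oplus>\<^bsub>UP A\<^esub>i\<in>{..deg A p}. monom (UP A) (a i) i)"
      using a x by (subst U.P.finsum_rdistr) auto
    finally show ?thesis using a
      by (intro bexI[of _ "\<Oplus>\<^bsub>UP A\<^esub>i\<in>{..deg A p}. monom (UP A) (a i) i"]) (auto intro!: U.P.finsum_closed)
  qed
  ultimately show ?thesis unfolding reduces_mod_def
    using h.map_coeffs_is_hom x by auto
qed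

text \<open>
  The division of \<open>p - p(0)\<close> by \<open>X\<close> is the Taylor expansion at \<open>0\<close> with the variable itself as
  increment.
\<close>

lemma reduces_mod_subst0_X:
  assumes R: "cring R"
  shows "reduces_mod (UP R) R (subst0_X R) (var R)"
proof -
  interpret c: ring_hom_cring R "UP R" "cst R" by (rule cst_is_hom[OF R])
  have i: "ring_hom_cring R R (\<lambda>r. r)" by (intro ring_hom_cringI R ring_hom_memI) auto
  have s: "ring_hom_cring (UP R) R (subst0_X R)"
    unfolding subst0_X_def by (rule ring_hom_cring.eval_is_hom[OF i c.R.zero_closed])
  interpret s: ring_hom_cring "UP R" R "subst0_X R" by fact
  have "\<exists>p\<in>carrier (UP R). subst0_X R p = b" if "b \<in> carrier R" for b
    using that ring_hom_cring.eval_cst[OF i c.R.zero_closed that]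
    by (intro bexI[of _ "cst R b"]) (auto simp: subst0_X_def)
  moreover have "\<exists>q\<in>carrier (UP R). p = var R \<otimes>\<^bsub>UP R\<^esub> q"
    if p: "p \<in> carrier (UP R)" and z: "subst0_X R p = \<zero>\<^bsub>R\<^esub>" for p
  proof -
    have e0: "eval R (UP R) (cst R) \<zero>\<^bsub>UP R\<^esub> p = \<zero>\<^bsub>UP R\<^esub>"
      using hom_eval[OF i c.ring_hom_cring_axioms c.ring_hom_cring_axioms
          c.R.zero_closed refl p] z by (simp add: subst0_X_def)
    obtain r where r: "r \<in> carrier (UP R)" and
      "eval R (UP R) (cst R) (\<zero>\<^bsub>UP R\<^esub> \<oplus>\<^bsub>UP R\<^esub> var R) p = eval R (UP R) (cst R) \<zero>\<^bsub>UP R\<^esub> p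
       \<oplus>\<^bsub>UP R\<^esub> var R \<otimes>\<^bsub>UP R\<^esub> eval R (UP R) (cst R) \<zero>\<^bsub>UP R\<^esub> (formal_deriv R p)
       \<oplus>\<^bsub>UP R\<^esub> var R \<otimes>\<^bsub>UP R\<^esub> var R \<otimes>\<^bsub>UP R\<^esub> r"
      using c.eval_taylor[OF p c.S.zero_closed c.var_closed] by blast
    moreover define q where "q = eval R (UP R) (cst R) \<zero>\<^bsub>UP R\<^esub> (formal_deriv R p)"
    moreover have q: "q \<in> carrier (UP R)" unfolding q_def using p by (intro c.eval_closed) auto
    ultimately have "p = var R \<otimes>\<^bsub>UP R\<^esub> q \<oplus>\<^bsub>UP R\<^esub> var R \<otimes>\<^bsub>UP R\<^esub> var R \<otimes>\<^bsub>UP R\<^esub> r"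
      by (simp add: e0 eval_at_generic[OF R p])
    also have "\<dots> = var R \<otimes>\<^bsub>UP R\<^esub> (q \<oplus>\<^bsub>UP R\<^esub> var R \<otimes>\<^bsub>UP R\<^esub> r)"
      using q r by (simp add: c.S.r_distr c.S.m_assoc)
    finally show ?thesis using q r by (intro bexI[of _ "q \<oplus>\<^bsub>UP R\<^esub> var R \<otimes>\<^bsub>UP R\<^esub> r"]) auto
  qed
  ultimately show ?thesis unfolding reduces_mod_def using s by auto
qed

lemma genideal3_one:
  assumes A: "cring A" and c: "a \<in> carrier A" "b \<in> carrier A" "c \<in> carrier A"
    and I: "Idl\<^bsub>A\<^esub> {a, b, c} = carrier A"
  shows "\<exists>\<alpha>\<in>carrier A. \<exists>\<beta>\<in>carrier A. \<exists>\<gamma>\<in>carrier A.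
    \<alpha> \<otimes>\<^bsub>A\<^esub> a \<oplus>\<^bsub>A\<^esub> \<beta> \<otimes>\<^bsub>A\<^esub> b \<oplus>\<^bsub>A\<^esub> \<gamma> \<otimes>\<^bsub>A\<^esub> c = \<one>\<^bsub>A\<^esub>"
proof -
  interpret A: cring A by fact
  let ?J = "PIdl\<^bsub>A\<^esub> a <+>\<^bsub>A\<^esub> PIdl\<^bsub>A\<^esub> b <+>\<^bsub>A\<^esub> PIdl\<^bsub>A\<^esub> c"
  have mem: "\<alpha> \<otimes>\<^bsub>A\<^esub> a \<oplus>\<^bsub>A\<^esub> \<beta> \<otimes>\<^bsub>A\<^esub> b \<oplus>\<^bsub>A\<^esub> \<gamma> \<otimes>\<^bsub>A\<^esub> c \<in> ?J"
    if "\<alpha> \<in> carrier A" "\<beta> \<in> carrier A" "\<gamma> \<in> carrier A" for \<alpha> \<beta> \<gamma>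
    unfolding set_add_def' cgenideal_def using that by blast
  have "ideal ?J A" by (intro A.add_ideals A.cgenideal_ideal c)
  moreover have "{a, b, c} \<subseteq> ?J"
    using mem[of "\<one>\<^bsub>A\<^esub>" "\<zero>\<^bsub>A\<^esub>" "\<zero>\<^bsub>A\<^esub>"] mem[of "\<zero>\<^bsub>A\<^esub>" "\<one>\<^bsub>A\<^esub>" "\<zero>\<^bsub>A\<^esub>"]
      mem[of "\<zero>\<^bsub>A\<^esub>" "\<zero>\<^bsub>A\<^esub>" "\<one>\<^bsub>A\<^esub>"] c by simp
  ultimately have "Idl\<^bsub>A\<^esub> {a, b, c} \<subseteq> ?J" by (rule A.genideal_minimal)
  then have "\<one>\<^bsub>A\<^esub> \<in> ?J" using I by auto
  then obtain \<alpha> \<beta> \<gamma> where "\<alpha> \<in> carrier A" "\<beta> \<in> carrier A" "\<gamma> \<in> carrier A"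
    "\<one>\<^bsub>A\<^esub> = \<alpha> \<otimes>\<^bsub>A\<^esub> a \<oplus>\<^bsub>A\<^esub> \<beta> \<otimes>\<^bsub>A\<^esub> b \<oplus>\<^bsub>A\<^esub> \<gamma> \<otimes>\<^bsub>A\<^esub> c"
    unfolding set_add_def' cgenideal_def by blast
  then show ?thesis by metis
qed

lemma lift_bezout:
  assumes "reduces_mod A B h x"
    and c: "a1 \<in> carrier A" "a2 \<in> carrier A" "a3 \<in> carrier A"
    and I: "Idl\<^bsub>B\<^esub> {h a1, h a2, h a3} = carrier B"
  shows "\<exists>\<alpha>\<in>carrier A. \<exists>\<beta>\<in>carrier A. \<exists>\<gamma>\<in>carrier A. \<exists>q\<in>carrier A.
    \<alpha> \<otimes>\<^bsub>A\<^esub> a1 \<oplus>\<^bsub>A\<^esub> \<beta> \<otimes>\<^bsub>A\<^esub> a2 \<oplus>\<^bsub>A\<^esub> \<gamma> \<otimes>\<^bsub>A\<^esub> a3 = \<one>\<^bsub>A\<^esub> \<oplus>\<^bsub>A\<^esub> x \<otimes>\<^bsub>A\<^esub> q"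
proof -
  from assms have h: "ring_hom_cring A B h" and x: "x \<in> carrier A"
    and surj: "\<And>b. b \<in> carrier B \<Longrightarrow> \<exists>a\<in>carrier A. h a = b"
    and ker: "\<And>a. a \<in> carrier A \<Longrightarrow> h a = \<zero>\<^bsub>B\<^esub> \<Longrightarrow> \<exists>q\<in>carrier A. a = x \<otimes>\<^bsub>A\<^esub> q"
    by (auto simp: reduces_mod_def)
  interpret h: ring_hom_cring A B h by fact
  obtain \<alpha>' \<beta>' \<gamma>' where "\<alpha>' \<in> carrier B" "\<beta>' \<in> carrier B" "\<gamma>' \<in> carrier B"
    and e: "\<alpha>' \<otimes>\<^bsub>B\<^esub> h a1 \<oplus>\<^bsub>B\<^esub> \<beta>' \<otimes>\<^bsub>B\<^esub> h a2 \<oplus>\<^bsub>B\<^esub> \<gamma>' \<otimes>\<^bsub>B\<^esub> h a3 = \<one>\<^bsub>B\<^esub>"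
    using genideal3_one[OF h.S.is_cring _ _ _ I] c by auto
  then obtain \<alpha> \<beta> \<gamma> where g: "\<alpha> \<in> carrier A" "\<beta> \<in> carrier A" "\<gamma> \<in> carrier A"
    and hg: "h \<alpha> = \<alpha>'" "h \<beta> = \<beta>'" "h \<gamma> = \<gamma>'" using surj by metis
  define s where "s = \<alpha> \<otimes>\<^bsub>A\<^esub> a1 \<oplus>\<^bsub>A\<^esub> \<beta> \<otimes>\<^bsub>A\<^esub> a2 \<oplus>\<^bsub>A\<^esub> \<gamma> \<otimes>\<^bsub>A\<^esub> a3"
  have s: "s \<in> carrier A" unfolding s_def using g c by simp
  have "h s = \<one>\<^bsub>B\<^esub>" unfolding s_def using g c e by (simp add: hg)
  then have "h (s \<ominus>\<^bsub>A\<^esub> \<one>\<^bsub>A\<^esub>) = \<zero>\<^bsub>B\<^esub>" using s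
    by (simp add: ring_hom_cring.hom_sub[OF h] ring.r_right_minus_eq[OF cring.axioms(1)[OF h.S.is_cring]])
  then obtain q where q: "q \<in> carrier A" "s \<ominus>\<^bsub>A\<^esub> \<one>\<^bsub>A\<^esub> = x \<otimes>\<^bsub>A\<^esub> q" using ker[of "s \<ominus>\<^bsub>A\<^esub> \<one>\<^bsub>A\<^esub>"] s by auto
  have "s = \<one>\<^bsub>A\<^esub> \<oplus>\<^bsub>A\<^esub> (s \<ominus>\<^bsub>A\<^esub> \<one>\<^bsub>A\<^esub>)" using s by algebra
  then have "s = \<one>\<^bsub>A\<^esub> \<oplus>\<^bsub>A\<^esub> x \<otimes>\<^bsub>A\<^esub> q" unfolding q(2) .
  then show ?thesis unfolding s_def using g q(1) by blast
qed

lemma (in cring) unit_mod_from_relation: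
  assumes "x \<in> carrier R" "\<delta> \<in> carrier R" "c \<in> carrier R" "s \<in> carrier R" "q \<in> carrier R"
    and "x \<otimes> s \<oplus> \<delta> \<otimes> c = \<one> \<oplus> x \<otimes> q"
  shows "\<delta> \<otimes> c = \<one> \<oplus> x \<otimes> (q \<ominus> s)"
proof -
  have "\<delta> \<otimes> c = (x \<otimes> s \<oplus> \<delta> \<otimes> c) \<ominus> x \<otimes> s" using assms(1-5) by algebra
  also have "\<dots> = \<one> \<oplus> x \<otimes> (q \<ominus> s)" unfolding assms(6) using assms(1-5) by algebra
  finally show ?thesis .
qed

text \<open>
  A product of two units modulo \<open>x\<close> is a unit modulo \<open>x\<close>, with an explicit cofactor of \<open>x\<close>.
\<close>

lemma (in cring) bezout_mult:
  assumes "x \<in> carrier R" "\<beta> \<in> carrier R" "p \<in> carrier R" "\<gamma> \<in> carrier R" "q \<in> carrier R"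
    and "s \<in> carrier R" "t \<in> carrier R"
    and "\<beta> \<otimes> p = \<one> \<oplus> x \<otimes> s" "\<gamma> \<otimes> q = \<one> \<oplus> x \<otimes> t"
  shows "x \<otimes> (\<ominus> (s \<oplus> t \<oplus> x \<otimes> s \<otimes> t)) \<oplus> (\<beta> \<otimes> \<gamma>) \<otimes> (p \<otimes> q) = \<one>"
proof -
  have "(\<beta> \<otimes> \<gamma>) \<otimes> (p \<otimes> q) = (\<beta> \<otimes> p) \<otimes> (\<gamma> \<otimes> q)" using assms(1-7) by algebra
  also have "\<dots> = \<one> \<oplus> x \<otimes> (s \<oplus> t \<oplus> x \<otimes> s \<otimes> t)" unfolding assms(8,9) using assms(1-7) by algebra
  finally show ?thesis using assms(1-7) by algebra
qed

text \<open>
  In \<open>B_j\<close> both \<open>P\<close> and \<open>Q\<close> are multiples of \<open>X\<close>, as \<open>d\<close> and \<open>j\<close> are positive. So the first unit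
  ideal hypothesis, lifted from \<open>X = 0\<close>, makes \<open>P'\<close> a unit modulo \<open>X\<close>, the second one does
  the same for \<open>Q'\<close>, and hence \<open>c = P' Q'\<close> is a unit modulo \<open>X\<close>.
\<close>

lemma (in B_algebra) bezout_in_B:
  assumes d: "d \<ge> 1" and j: "j \<ge> 1"
    and I1: "Idl\<^bsub>UP R\<^esub> {subst0_XZ R P, subst0_XZ R (formal_deriv (UP R) P)} = carrier (UP R)"
    and I2: "Idl\<^bsub>UP (UP R)\<^esub> {cst (UP R) (subst0_XZ R P), subst0_XYZ R Q,
           subst0_XYZ R (formal_deriv (UP (UP R)) Q)} = carrier (UP (UP R))"
    and c: "c = cst (UP (UP R)) (formal_deriv (UP R) P) \<otimes>\<^bsub>UP (UP (UP R))\<^esub> formal_deriv (UP (UP R)) Q"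
  shows "\<exists>a\<in>carrier G. \<exists>b\<in>carrier G.
    proj (var1 R) \<otimes>\<^bsub>B\<^esub> proj a \<oplus>\<^bsub>B\<^esub> proj b \<otimes>\<^bsub>B\<^esub> proj (cst (UP (UP (UP R))) c) = \<one>\<^bsub>B\<^esub>"
proof -
  interpret c0: ring_hom_cring R "UP R" "cst R" by (rule cst_is_hom[OF cring_R])
  interpret c1: ring_hom_cring "UP R" "UP (UP R)" "cst (UP R)"
    by (intro cst_is_hom cring_UP cring_R)
  interpret c2: ring_hom_cring "UP (UP R)" "UP (UP (UP R))" "cst (UP (UP R))"
    by (intro cst_is_hom cring_UP cring_R)
  interpret c3: ring_hom_cring "UP (UP (UP R))" G "cst (UP (UP (UP R)))"
    by (intro cst_is_hom cring_UP cring_R)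
  interpret \<pi>: ring_hom_cring G B proj by (rule proj_is_hom)
  note P = P_closed and Q = Q_closed
  note P' = c1.formal_deriv_closed[OF P] and Q' = c2.formal_deriv_closed[OF Q]
  note r1 = reduces_mod_subst0_X[OF cring_R]
  note r2 = reduces_mod_map_coeffs[OF r1, folded subst0_XZ_def]
  note r3 = reduces_mod_map_coeffs[OF r2, folded subst0_XYZ_def]
  have r2h: "ring_hom_cring (UP (UP R)) (UP R) (subst0_XZ R)" using r2 by (simp add: reduces_mod_def)
  \<comment> \<open>\<open>lift_bezout\<close> takes three generators; the first hypothesis has two, so one of them is repeated.\<close>
  have I1': "Idl\<^bsub>UP R\<^esub> {subst0_XZ R P, subst0_XZ R (formal_deriv (UP R) P), subst0_XZ R (formal_deriv (UP R) P)}
     = carrier (UP R)" using I1 by simp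
  have I2': "Idl\<^bsub>UP (UP R)\<^esub> {subst0_XYZ R (cst (UP (UP R)) P), subst0_XYZ R Q,
     subst0_XYZ R (formal_deriv (UP (UP R)) Q)} = carrier (UP (UP R))"
    using I2 ring_hom_cring.map_coeffs_cst[OF r2h P] by (simp add: subst0_XYZ_def)
  define k where "k f = proj (cst (UP (UP (UP R))) f)" for f
  interpret k: ring_hom_cring "UP (UP (UP R))" B k
  proof (rule ring_hom_cringI[OF cring_UP[OF cring_UP[OF cring_UP[OF cring_R]]] cring_B])
    show "k \<in> ring_hom (UP (UP (UP R))) B" unfolding k_def by (rule ring_hom_memI) auto
  qed
  define x where "x = proj (var1 R)"
  define k2 where "k2 f = k (cst (UP (UP R)) f)" for f
  interpret k2: ring_hom_cring "UP (UP R)" B k2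
  proof (rule ring_hom_cringI[OF cring_UP[OF cring_UP[OF cring_R]] cring_B])
    show "k2 \<in> ring_hom (UP (UP R)) B" unfolding k2_def by (rule ring_hom_memI) auto
  qed
  have x2: "k2 (cst (UP R) (var R)) = x" "k (cst (UP (UP R)) (cst (UP R) (var R))) = x"
    unfolding k2_def k_def x_def var1_def by simp_all
  have x: "x \<in> carrier B" unfolding x_def using vars_closed[OF cring_R] by simp
  define y t where "y = proj (var3 R)" and "t = proj (var4 R)"
  have yt: "y \<in> carrier B" "t \<in> carrier B" unfolding y_def t_def using vars_closed[OF cring_R] by auto
  have pw: "x [^]\<^bsub>B\<^esub> i = x \<otimes>\<^bsub>B\<^esub> x [^]\<^bsub>B\<^esub> (i - 1)" if "i \<ge> 1" for i :: nat
    using that \<pi>.S.nat_pow_Suc2[OF x, of "i - 1"] by simp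
  define p0 q0 where "p0 = x [^]\<^bsub>B\<^esub> (d - 1) \<otimes>\<^bsub>B\<^esub> y" and "q0 = x [^]\<^bsub>B\<^esub> (j - 1) \<otimes>\<^bsub>B\<^esub> t"
  have pq0: "p0 \<in> carrier B" "q0 \<in> carrier B" unfolding p0_def q0_def using x yt by auto
  have kP: "k2 P = x \<otimes>\<^bsub>B\<^esub> p0" and kQ: "k Q = x \<otimes>\<^bsub>B\<^esub> q0"
    using proj_rels pw[OF d] pw[OF j] x yt
    unfolding k2_def k_def p0_def q0_def x_def[symmetric] y_def[symmetric] t_def[symmetric]
    by (simp_all add: \<pi>.S.m_assoc)
  obtain \<alpha> \<beta> \<gamma> q where g: "\<alpha> \<in> carrier (UP (UP R))" "\<beta> \<in> carrier (UP (UP R))"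
      "\<gamma> \<in> carrier (UP (UP R))" "q \<in> carrier (UP (UP R))"
    and e: "\<alpha> \<otimes>\<^bsub>UP (UP R)\<^esub> P \<oplus>\<^bsub>UP (UP R)\<^esub> \<beta> \<otimes>\<^bsub>UP (UP R)\<^esub> formal_deriv (UP R) P
      \<oplus>\<^bsub>UP (UP R)\<^esub> \<gamma> \<otimes>\<^bsub>UP (UP R)\<^esub> formal_deriv (UP R) P =
      \<one>\<^bsub>UP (UP R)\<^esub> \<oplus>\<^bsub>UP (UP R)\<^esub> cst (UP R) (var R) \<otimes>\<^bsub>UP (UP R)\<^esub> q"
    using lift_bezout[OF r2, OF P P' P' I1'] by blast
  obtain \<alpha>1 \<beta>1 \<gamma>1 q1 where g1: "\<alpha>1 \<in> carrier (UP (UP (UP R)))" "\<beta>1 \<in> carrier (UP (UP (UP R)))"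
      "\<gamma>1 \<in> carrier (UP (UP (UP R)))" "q1 \<in> carrier (UP (UP (UP R)))"
    and e1: "\<alpha>1 \<otimes>\<^bsub>UP (UP (UP R))\<^esub> cst (UP (UP R)) P \<oplus>\<^bsub>UP (UP (UP R))\<^esub> \<beta>1 \<otimes>\<^bsub>UP (UP (UP R))\<^esub> Q
      \<oplus>\<^bsub>UP (UP (UP R))\<^esub> \<gamma>1 \<otimes>\<^bsub>UP (UP (UP R))\<^esub> formal_deriv (UP (UP R)) Q =
      \<one>\<^bsub>UP (UP (UP R))\<^esub> \<oplus>\<^bsub>UP (UP (UP R))\<^esub> cst (UP (UP R)) (cst (UP R) (var R)) \<otimes>\<^bsub>UP (UP (UP R))\<^esub> q1"
    using lift_bezout[OF r3, OF c2.hom_closed[OF P] Q Q' I2'] by blast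
  define p' q' where "p' = k2 (formal_deriv (UP R) P)" and "q' = k (formal_deriv (UP (UP R)) Q)"
  have p'q': "p' \<in> carrier B" "q' \<in> carrier B" unfolding p'_def q'_def using P' Q' by auto
  have gc: "k2 \<alpha> \<in> carrier B" "k2 \<beta> \<in> carrier B" "k2 \<gamma> \<in> carrier B" "k2 q \<in> carrier B"
    "k \<alpha>1 \<in> carrier B" "k \<beta>1 \<in> carrier B" "k \<gamma>1 \<in> carrier B" "k q1 \<in> carrier B"
    using g g1 by auto
  have "k2 \<alpha> \<otimes>\<^bsub>B\<^esub> (x \<otimes>\<^bsub>B\<^esub> p0) \<oplus>\<^bsub>B\<^esub> k2 \<beta> \<otimes>\<^bsub>B\<^esub> p' \<oplus>\<^bsub>B\<^esub> k2 \<gamma> \<otimes>\<^bsub>B\<^esub> p' = \<one>\<^bsub>B\<^esub> \<oplus>\<^bsub>B\<^esub> x \<otimes>\<^bsub>B\<^esub> k2 q"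
    using arg_cong[where f = k2, OF e] g P P' unfolding p'_def by (simp add: kP x2)
  moreover have "k2 \<alpha> \<otimes>\<^bsub>B\<^esub> (x \<otimes>\<^bsub>B\<^esub> p0) \<oplus>\<^bsub>B\<^esub> k2 \<beta> \<otimes>\<^bsub>B\<^esub> p' \<oplus>\<^bsub>B\<^esub> k2 \<gamma> \<otimes>\<^bsub>B\<^esub> p' =
      x \<otimes>\<^bsub>B\<^esub> (k2 \<alpha> \<otimes>\<^bsub>B\<^esub> p0) \<oplus>\<^bsub>B\<^esub> (k2 \<beta> \<oplus>\<^bsub>B\<^esub> k2 \<gamma>) \<otimes>\<^bsub>B\<^esub> p'"
    using gc(1-3) x pq0 p'q' by algebra
  ultimately have "x \<otimes>\<^bsub>B\<^esub> (k2 \<alpha> \<otimes>\<^bsub>B\<^esub> p0) \<oplus>\<^bsub>B\<^esub> (k2 \<beta> \<oplus>\<^bsub>B\<^esub> k2 \<gamma>) \<otimes>\<^bsub>B\<^esub> p' = \<one>\<^bsub>B\<^esub> \<oplus>\<^bsub>B\<^esub> x \<otimes>\<^bsub>B\<^esub> k2 q"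
    by simp
  then have u1: "(k2 \<beta> \<oplus>\<^bsub>B\<^esub> k2 \<gamma>) \<otimes>\<^bsub>B\<^esub> p' = \<one>\<^bsub>B\<^esub> \<oplus>\<^bsub>B\<^esub> x \<otimes>\<^bsub>B\<^esub> (k2 q \<ominus>\<^bsub>B\<^esub> k2 \<alpha> \<otimes>\<^bsub>B\<^esub> p0)"
    using gc x pq0 p'q' by (intro \<pi>.S.unit_mod_from_relation) auto
  have "k \<alpha>1 \<otimes>\<^bsub>B\<^esub> (x \<otimes>\<^bsub>B\<^esub> p0) \<oplus>\<^bsub>B\<^esub> k \<beta>1 \<otimes>\<^bsub>B\<^esub> (x \<otimes>\<^bsub>B\<^esub> q0) \<oplus>\<^bsub>B\<^esub> k \<gamma>1 \<otimes>\<^bsub>B\<^esub> q' = \<one>\<^bsub>B\<^esub> \<oplus>\<^bsub>B\<^esub> x \<otimes>\<^bsub>B\<^esub> k q1"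
    using arg_cong[where f = k, OF e1] g1 P Q Q' unfolding q'_def by (simp add: kP[unfolded k2_def] kQ x2)
  moreover have "k \<alpha>1 \<otimes>\<^bsub>B\<^esub> (x \<otimes>\<^bsub>B\<^esub> p0) \<oplus>\<^bsub>B\<^esub> k \<beta>1 \<otimes>\<^bsub>B\<^esub> (x \<otimes>\<^bsub>B\<^esub> q0) \<oplus>\<^bsub>B\<^esub> k \<gamma>1 \<otimes>\<^bsub>B\<^esub> q' =
      x \<otimes>\<^bsub>B\<^esub> (k \<alpha>1 \<otimes>\<^bsub>B\<^esub> p0 \<oplus>\<^bsub>B\<^esub> k \<beta>1 \<otimes>\<^bsub>B\<^esub> q0) \<oplus>\<^bsub>B\<^esub> k \<gamma>1 \<otimes>\<^bsub>B\<^esub> q'"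
    using gc(5-7) x pq0 p'q' by algebra
  ultimately have "x \<otimes>\<^bsub>B\<^esub> (k \<alpha>1 \<otimes>\<^bsub>B\<^esub> p0 \<oplus>\<^bsub>B\<^esub> k \<beta>1 \<otimes>\<^bsub>B\<^esub> q0) \<oplus>\<^bsub>B\<^esub> k \<gamma>1 \<otimes>\<^bsub>B\<^esub> q' = \<one>\<^bsub>B\<^esub> \<oplus>\<^bsub>B\<^esub> x \<otimes>\<^bsub>B\<^esub> k q1"
    by simp
  then have u2: "k \<gamma>1 \<otimes>\<^bsub>B\<^esub> q' = \<one>\<^bsub>B\<^esub> \<oplus>\<^bsub>B\<^esub> x \<otimes>\<^bsub>B\<^esub> (k q1 \<ominus>\<^bsub>B\<^esub> (k \<alpha>1 \<otimes>\<^bsub>B\<^esub> p0 \<oplus>\<^bsub>B\<^esub> k \<beta>1 \<otimes>\<^bsub>B\<^esub> q0))"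
    using gc x pq0 p'q' by (intro \<pi>.S.unit_mod_from_relation) auto
  have kc: "k c = p' \<otimes>\<^bsub>B\<^esub> q'" unfolding c p'_def q'_def k2_def using P' Q' by simp
  define s1 s2 where "s1 = k2 q \<ominus>\<^bsub>B\<^esub> k2 \<alpha> \<otimes>\<^bsub>B\<^esub> p0"
    and "s2 = k q1 \<ominus>\<^bsub>B\<^esub> (k \<alpha>1 \<otimes>\<^bsub>B\<^esub> p0 \<oplus>\<^bsub>B\<^esub> k \<beta>1 \<otimes>\<^bsub>B\<^esub> q0)"
  have s: "s1 \<in> carrier B" "s2 \<in> carrier B" unfolding s1_def s2_def using gc x pq0 by simp_all
  have "\<exists>a\<in>carrier B. \<exists>b\<in>carrier B. x \<otimes>\<^bsub>B\<^esub> a \<oplus>\<^bsub>B\<^esub> b \<otimes>\<^bsub>B\<^esub> (p' \<otimes>\<^bsub>B\<^esub> q') = \<one>\<^bsub>B\<^esub>"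
  proof (intro bexI)
    show "x \<otimes>\<^bsub>B\<^esub> (\<ominus>\<^bsub>B\<^esub> (s1 \<oplus>\<^bsub>B\<^esub> s2 \<oplus>\<^bsub>B\<^esub> x \<otimes>\<^bsub>B\<^esub> s1 \<otimes>\<^bsub>B\<^esub> s2)) \<oplus>\<^bsub>B\<^esub>
      ((k2 \<beta> \<oplus>\<^bsub>B\<^esub> k2 \<gamma>) \<otimes>\<^bsub>B\<^esub> k \<gamma>1) \<otimes>\<^bsub>B\<^esub> (p' \<otimes>\<^bsub>B\<^esub> q') = \<one>\<^bsub>B\<^esub>"
      by (rule \<pi>.S.bezout_mult[OF x _ p'q'(1) gc(7) p'q'(2) s u1[folded s1_def] u2[folded s2_def]])
         (simp add: gc)
  qed (simp_all add: gc x s)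
  then obtain a b where ab: "a \<in> carrier B" "b \<in> carrier B"
    and e: "x \<otimes>\<^bsub>B\<^esub> a \<oplus>\<^bsub>B\<^esub> b \<otimes>\<^bsub>B\<^esub> (p' \<otimes>\<^bsub>B\<^esub> q') = \<one>\<^bsub>B\<^esub>" by blast
  obtain a' where a': "a' \<in> carrier G" "a = proj a'" using proj_surj[OF ab(1)] by (rule bexE)
  obtain b' where b': "b' \<in> carrier G" "b = proj b'" using proj_surj[OF ab(2)] by (rule bexE)
  show ?thesis
    using e unfolding kc[symmetric] a'(2) b'(2) unfolding k_def x_def
    by (intro bexI[OF _ a'(1)] bexI[OF _ b'(1)])
qed

section \<open>Exchanging the two cylinders\<close>

text \<open>
  The polynomials from which the isomorphism between the cylinders over \<open>B_(j+1)\<close> and \<open>B_j\<close> is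
  built. The variables of \<open>w\<close> and \<open>g\<close> stand for \<open>x, z, u, y\<close>, those of \<open>a\<close> and \<open>b\<close> for the
  coordinates \<open>x, z', y', t'\<close> of a point of \<open>Spec B_j\<close>, and those of \<open>c\<close> for \<open>x, z', y'\<close>.
\<close>

locale cylinder_exchange = B_algebra R d j P Q for R :: "('a, 'm) ring_scheme" (structure) and d j P Q +
  fixes w g a b c
  assumes w_closed: "w \<in> carrier (UP (UP (UP (UP R))))"
    and g_closed: "g \<in> carrier (UP (UP (UP (UP R))))"
    and a_closed: "a \<in> carrier (UP (UP (UP (UP R))))"
    and b_closed: "b \<in> carrier (UP (UP (UP (UP R))))"
    and c_closed: "c \<in> carrier (UP (UP (UP R)))"
    and translates_P_generic:
      "translates_P R G (const4 R) d j P w (var1 R) (var2 R) (var3 R)"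
    and translates_Q_generic:
      "translates_Q R G (const4 R) d j Q w g c (var1 R) (var2 R) (var3 R) (var4 R)"
    and bezout: "proj (var1 R) \<otimes>\<^bsub>B\<^esub> proj a \<oplus>\<^bsub>B\<^esub> proj b \<otimes>\<^bsub>B\<^esub> proj (cst (UP (UP (UP R))) c) = \<one>\<^bsub>B\<^esub>"
begin

lemma translates_at:
  assumes \<rho>: "ring_hom_cring R M \<rho>"
    and pt: "x \<in> carrier M" "z \<in> carrier M" "u \<in> carrier M"
  shows "translates_P R M \<rho> d j P w x z u"
    and "y \<in> carrier M \<Longrightarrow> translates_Q R M \<rho> d j Q w g c x z u y"
proof -
  interpret \<rho>: ring_hom_cring R M \<rho> by fact
  note K = const4_is_hom[OF cring_R]
  note v = vars_closed[OF cring_R]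
  have 0: "\<zero>\<^bsub>M\<^esub> \<in> carrier M" by simp
  \<comment> \<open>The identity for \<open>P\<close> does not involve the fourth coordinate, for which zero is put.\<close>
  note e0 = \<rho>.eval4_generic[OF pt 0]
  show "translates_P R M \<rho> d j P w x z u"
    using hom_translates_P[OF K \<rho> \<rho>.eval4_is_hom[OF pt 0] e0(1) v(1-3) w_closed P_closed translates_P_generic]
    unfolding e0 .
  assume y: "y \<in> carrier M"
  note e = \<rho>.eval4_generic[OF pt y]
  show "translates_Q R M \<rho> d j Q w g c x z u y"
    using hom_translates_Q[OF K \<rho> \<rho>.eval4_is_hom[OF pt y] e(1) v w_closed Q_closed g_closed c_closed translates_Q_generic]
    unfolding e .
qed

lemma bezout_at:
  assumes \<rho>: "ring_hom_cring R M \<rho>" and pt: "is_point R M \<rho> d j P Q x z y t"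
  shows "x \<otimes>\<^bsub>M\<^esub> eval4 R M \<rho> x z y t a \<oplus>\<^bsub>M\<^esub> eval4 R M \<rho> x z y t b \<otimes>\<^bsub>M\<^esub> eval3 R M \<rho> x z y c = \<one>\<^bsub>M\<^esub>"
proof -
  interpret \<rho>: ring_hom_cring R M \<rho> by fact
  interpret \<pi>: ring_hom_cring G B proj by (rule proj_is_hom)
  interpret c3: ring_hom_cring "UP (UP (UP R))" G "cst (UP (UP (UP R)))"
    by (intro cst_is_hom cring_UP cring_R)
  have cl: "x \<in> carrier M" "z \<in> carrier M" "y \<in> carrier M" "t \<in> carrier M"
    using pt by (auto simp: is_point_def)
  obtain f where f: "f \<in> ring_hom B M"
    and fp: "\<And>p. p \<in> carrier G \<Longrightarrow> f (proj p) = eval4 R M \<rho> x z y t p"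
    using hom_from_B[OF \<rho> pt] by blast
  interpret f: ring_hom_cring B M f by (intro ring_hom_cringI cring_B \<rho>.S.is_cring f)
  show ?thesis
    using arg_cong[where f = f, OF bezout] vars_closed(1)[OF cring_R] a_closed b_closed c_closed
    by (simp add: fp \<rho>.eval4_generic[OF cl] \<rho>.eval4_cst[OF cl])
qed

text \<open>
  The isomorphism on points, from level \<open>j + 1\<close> to level \<open>j\<close>, and its inverse. Both pass through
  \<open>s = t + u g\<close>, in terms of which \<open>x s + c u = t'\<close>.
\<close>

definition descend where
  "descend M \<rho> = (\<lambda>(x, z, y, t, u).
    let z' = translate_Z M d j x z u; y' = translate_Y R M \<rho> j w x z u y;
        s = t \<oplus>\<^bsub>M\<^esub> u \<otimes>\<^bsub>M\<^esub> eval4 R M \<rho> x z u y g;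
        t' = x \<otimes>\<^bsub>M\<^esub> s \<oplus>\<^bsub>M\<^esub> eval3 R M \<rho> x z' y' c \<otimes>\<^bsub>M\<^esub> u
    in (x, z', y', t', eval4 R M \<rho> x z' y' t' b \<otimes>\<^bsub>M\<^esub> s \<ominus>\<^bsub>M\<^esub> eval4 R M \<rho> x z' y' t' a \<otimes>\<^bsub>M\<^esub> u))"

definition ascend where
  "ascend M \<rho> = (\<lambda>(x, z', y', t', v).
    let u = eval4 R M \<rho> x z' y' t' b \<otimes>\<^bsub>M\<^esub> t' \<ominus>\<^bsub>M\<^esub> x \<otimes>\<^bsub>M\<^esub> v;
        s = eval4 R M \<rho> x z' y' t' a \<otimes>\<^bsub>M\<^esub> t' \<oplus>\<^bsub>M\<^esub> eval3 R M \<rho> x z' y' c \<otimes>\<^bsub>M\<^esub> v;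
        z = z' \<ominus>\<^bsub>M\<^esub> x [^]\<^bsub>M\<^esub> d \<otimes>\<^bsub>M\<^esub> x [^]\<^bsub>M\<^esub> j \<otimes>\<^bsub>M\<^esub> u;
        y = y' \<ominus>\<^bsub>M\<^esub> x [^]\<^bsub>M\<^esub> j \<otimes>\<^bsub>M\<^esub> u \<otimes>\<^bsub>M\<^esub> slope R M \<rho> w x z u
    in (x, z, y, s \<ominus>\<^bsub>M\<^esub> u \<otimes>\<^bsub>M\<^esub> eval4 R M \<rho> x z u y g, u))"

end

context cring
begin

text \<open>
  The matrix with rows \<open>(x, c)\<close> and \<open>(b, - a)\<close> maps \<open>(s, u)\<close> to \<open>(t', v)\<close>. Its determinant is
  \<open>- (x a + b c) = - 1\<close>, and its inverse has the rows \<open>(a, c)\<close> and \<open>(b, - x)\<close>; this lemma and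
  \<open>solve_linear'\<close> are the two halves of that statement.
\<close>

lemma solve_linear:
  assumes "x \<in> carrier R" "a \<in> carrier R" "b \<in> carrier R" "c \<in> carrier R"
    and "t \<in> carrier R" "v \<in> carrier R" and one: "x \<otimes> a \<oplus> b \<otimes> c = \<one>"
  shows "x \<otimes> (a \<otimes> t \<oplus> c \<otimes> v) \<oplus> c \<otimes> (b \<otimes> t \<ominus> x \<otimes> v) = t"
    and "b \<otimes> (a \<otimes> t \<oplus> c \<otimes> v) \<ominus> a \<otimes> (b \<otimes> t \<ominus> x \<otimes> v) = v"
proof -
  have "x \<otimes> (a \<otimes> t \<oplus> c \<otimes> v) \<oplus> c \<otimes> (b \<otimes> t \<ominus> x \<otimes> v) = (x \<otimes> a \<oplus> b \<otimes> c) \<otimes> t"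
    using assms(1-6) by algebra
  then show "x \<otimes> (a \<otimes> t \<oplus> c \<otimes> v) \<oplus> c \<otimes> (b \<otimes> t \<ominus> x \<otimes> v) = t" unfolding one using assms(5) by simp
  have "b \<otimes> (a \<otimes> t \<oplus> c \<otimes> v) \<ominus> a \<otimes> (b \<otimes> t \<ominus> x \<otimes> v) = (x \<otimes> a \<oplus> b \<otimes> c) \<otimes> v"
    using assms(1-6) by algebra
  then show "b \<otimes> (a \<otimes> t \<oplus> c \<otimes> v) \<ominus> a \<otimes> (b \<otimes> t \<ominus> x \<otimes> v) = v" unfolding one using assms(6) by simp
qed

lemma solve_linear':
  assumes "x \<in> carrier R" "a \<in> carrier R" "b \<in> carrier R" "c \<in> carrier R"
    and "s \<in> carrier R" "u \<in> carrier R" and one: "x \<otimes> a \<oplus> b \<otimes> c = \<one>"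
  shows "a \<otimes> (x \<otimes> s \<oplus> c \<otimes> u) \<oplus> c \<otimes> (b \<otimes> s \<ominus> a \<otimes> u) = s"
    and "b \<otimes> (x \<otimes> s \<oplus> c \<otimes> u) \<ominus> x \<otimes> (b \<otimes> s \<ominus> a \<otimes> u) = u"
proof -
  have "a \<otimes> (x \<otimes> s \<oplus> c \<otimes> u) \<oplus> c \<otimes> (b \<otimes> s \<ominus> a \<otimes> u) = (x \<otimes> a \<oplus> b \<otimes> c) \<otimes> s"
    using assms(1-6) by algebra
  then show "a \<otimes> (x \<otimes> s \<oplus> c \<otimes> u) \<oplus> c \<otimes> (b \<otimes> s \<ominus> a \<otimes> u) = s" unfolding one using assms(5) by simp
  have "b \<otimes> (x \<otimes> s \<oplus> c \<otimes> u) \<ominus> x \<otimes> (b \<otimes> s \<ominus> a \<otimes> u) = (x \<otimes> a \<oplus> b \<otimes> c) \<otimes> u"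
    using assms(1-6) by algebra
  then show "b \<otimes> (x \<otimes> s \<oplus> c \<otimes> u) \<ominus> x \<otimes> (b \<otimes> s \<ominus> a \<otimes> u) = u" unfolding one using assms(6) by simp
qed

lemma a_minus_cancel:
  assumes "a \<in> carrier R" "b \<in> carrier R"
  shows "(a \<ominus> b) \<oplus> b = a" "(a \<oplus> b) \<ominus> b = a"
  using assms by algebra+

end

context cylinder_exchange
begin

text \<open>
  Under the translation the two sides of each defining equation change by the same amount. For the
  second equation, \<open>x^(j+1) t = Q\<close> at level \<open>j + 1\<close> turns into \<open>x^j t' = Q\<close> at level \<open>j\<close> because
  \<open>t'\<close> contains \<open>t\<close> with the factor \<open>x\<close>.
\<close>

lemma point_translate_iff:
  assumes \<rho>: "ring_hom_cring R M \<rho>"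
    and c: "x \<in> carrier M" "z \<in> carrier M" "y \<in> carrier M" "s \<in> carrier M" "u \<in> carrier M"
  defines "z' \<equiv> translate_Z M d j x z u" and "y' \<equiv> translate_Y R M \<rho> j w x z u y"
  shows "is_point R M \<rho> d (Suc j) P Q x z y (s \<ominus>\<^bsub>M\<^esub> u \<otimes>\<^bsub>M\<^esub> eval4 R M \<rho> x z u y g) \<longleftrightarrow>
    is_point R M \<rho> d j P Q x z' y' (x \<otimes>\<^bsub>M\<^esub> s \<oplus>\<^bsub>M\<^esub> eval3 R M \<rho> x z' y' c \<otimes>\<^bsub>M\<^esub> u)"
proof -
  interpret \<rho>: ring_hom_cring R M \<rho> by fact
  note mc = \<rho>.translations_closed[OF c(1,2,5) w_closed]
  have z': "z' \<in> carrier M" and y': "y' \<in> carrier M" unfolding z'_def y'_def using mc c by auto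
  define A E where "A = x [^]\<^bsub>M\<^esub> d" and "E = x [^]\<^bsub>M\<^esub> j"
  define k gg cc where "k = slope R M \<rho> w x z u" and "gg = eval4 R M \<rho> x z u y g"
    and "cc = eval3 R M \<rho> x z' y' c"
  define p q p' q' where "p = eval2 R M \<rho> x z P" and "q = eval3 R M \<rho> x z y Q"
    and "p' = eval2 R M \<rho> x z' P" and "q' = eval3 R M \<rho> x z' y' Q"
  have cl: "A \<in> carrier M" "E \<in> carrier M" "k \<in> carrier M" "gg \<in> carrier M" "cc \<in> carrier M"
    unfolding A_def E_def k_def gg_def cc_def
    using c mc z' y' c_closed g_closed by (auto intro!: \<rho>.eval3_closed \<rho>.eval4_closed)
  have pq: "p \<in> carrier M" "q \<in> carrier M"
    unfolding p_def q_def using c z' y' P_closed Q_closed by (auto intro!: \<rho>.eval2_closed \<rho>.eval3_closed)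
  have p': "p' = p \<oplus>\<^bsub>M\<^esub> A \<otimes>\<^bsub>M\<^esub> E \<otimes>\<^bsub>M\<^esub> u \<otimes>\<^bsub>M\<^esub> k"
    using translates_at(1)[OF \<rho> c(1,2,5)] unfolding translates_P_def p'_def p_def A_def E_def k_def z'_def .
  have q': "q' = q \<oplus>\<^bsub>M\<^esub> E \<otimes>\<^bsub>M\<^esub> u \<otimes>\<^bsub>M\<^esub> (cc \<oplus>\<^bsub>M\<^esub> x \<otimes>\<^bsub>M\<^esub> gg)"
    using translates_at(2)[OF \<rho> c(1,2,5,3)]
    unfolding translates_Q_def q'_def q_def E_def gg_def cc_def z'_def y'_def .
  have y'_eq: "y' = y \<oplus>\<^bsub>M\<^esub> E \<otimes>\<^bsub>M\<^esub> u \<otimes>\<^bsub>M\<^esub> k" unfolding y'_def translate_Y_def E_def k_def ..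
  have e1: "A \<otimes>\<^bsub>M\<^esub> y' = A \<otimes>\<^bsub>M\<^esub> y \<oplus>\<^bsub>M\<^esub> A \<otimes>\<^bsub>M\<^esub> E \<otimes>\<^bsub>M\<^esub> u \<otimes>\<^bsub>M\<^esub> k"
    unfolding y'_eq using cl(1-3) c(3,5) by algebra
  have e2: "E \<otimes>\<^bsub>M\<^esub> (x \<otimes>\<^bsub>M\<^esub> s \<oplus>\<^bsub>M\<^esub> cc \<otimes>\<^bsub>M\<^esub> u) =
      E \<otimes>\<^bsub>M\<^esub> x \<otimes>\<^bsub>M\<^esub> (s \<ominus>\<^bsub>M\<^esub> u \<otimes>\<^bsub>M\<^esub> gg) \<oplus>\<^bsub>M\<^esub> E \<otimes>\<^bsub>M\<^esub> u \<otimes>\<^bsub>M\<^esub> (cc \<oplus>\<^bsub>M\<^esub> x \<otimes>\<^bsub>M\<^esub> gg)"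
    using cl(2,4,5) c(1,4,5) by algebra
  have i1: "A \<otimes>\<^bsub>M\<^esub> y' = p' \<longleftrightarrow> A \<otimes>\<^bsub>M\<^esub> y = p"
    unfolding e1 p' using cl c pq by (simp add: \<rho>.S.add.right_cancel)
  have i2: "E \<otimes>\<^bsub>M\<^esub> (x \<otimes>\<^bsub>M\<^esub> s \<oplus>\<^bsub>M\<^esub> cc \<otimes>\<^bsub>M\<^esub> u) = q' \<longleftrightarrow> E \<otimes>\<^bsub>M\<^esub> x \<otimes>\<^bsub>M\<^esub> (s \<ominus>\<^bsub>M\<^esub> u \<otimes>\<^bsub>M\<^esub> gg) = q"
    unfolding e2 q' using cl c pq by (simp add: \<rho>.S.add.right_cancel)
  show ?thesis
    unfolding is_point_def gg_def[symmetric] cc_def[symmetric] \<rho>.S.nat_pow_Suc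
      A_def[symmetric] E_def[symmetric] p_def[symmetric] q_def[symmetric] p'_def[symmetric]
      q'_def[symmetric] i1 i2
    using c cl z' y' by simp
qed

text \<open>
  The next two lemmas name the intermediate quantities of the two maps and record the equations
  between them, in the form in which the opposite map recovers its argument.
\<close>

lemma descend_cases:
  assumes \<rho>: "ring_hom_cring R M \<rho>" and \<tau>: "(x, z, y, t, u) \<in> cylinder_points R M \<rho> d (Suc j) P Q"
  obtains z' y' t' s v where "descend M \<rho> (x, z, y, t, u) = (x, z', y', t', v)"
    and "z' = translate_Z M d j x z u" "y' = translate_Y R M \<rho> j w x z u y"
    and "s = t \<oplus>\<^bsub>M\<^esub> u \<otimes>\<^bsub>M\<^esub> eval4 R M \<rho> x z u y g"
    and "t = s \<ominus>\<^bsub>M\<^esub> u \<otimes>\<^bsub>M\<^esub> eval4 R M \<rho> x z u y g"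
    and "t' = x \<otimes>\<^bsub>M\<^esub> s \<oplus>\<^bsub>M\<^esub> eval3 R M \<rho> x z' y' c \<otimes>\<^bsub>M\<^esub> u"
    and "v = eval4 R M \<rho> x z' y' t' b \<otimes>\<^bsub>M\<^esub> s \<ominus>\<^bsub>M\<^esub> eval4 R M \<rho> x z' y' t' a \<otimes>\<^bsub>M\<^esub> u"
    and "(x, z', y', t', v) \<in> cylinder_points R M \<rho> d j P Q" and "s \<in> carrier M"
proof -
  interpret \<rho>: ring_hom_cring R M \<rho> by fact
  have pt: "is_point R M \<rho> d (Suc j) P Q x z y t" and u: "u \<in> carrier M"
    using \<tau> by (auto simp: cylinder_points_def)
  have cl: "x \<in> carrier M" "z \<in> carrier M" "y \<in> carrier M" "t \<in> carrier M"
    using pt by (auto simp: is_point_def)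
  define z' y' where "z' = translate_Z M d j x z u" and "y' = translate_Y R M \<rho> j w x z u y"
  define s where "s = t \<oplus>\<^bsub>M\<^esub> u \<otimes>\<^bsub>M\<^esub> eval4 R M \<rho> x z u y g"
  define t' where "t' = x \<otimes>\<^bsub>M\<^esub> s \<oplus>\<^bsub>M\<^esub> eval3 R M \<rho> x z' y' c \<otimes>\<^bsub>M\<^esub> u"
  define v where "v = eval4 R M \<rho> x z' y' t' b \<otimes>\<^bsub>M\<^esub> s \<ominus>\<^bsub>M\<^esub> eval4 R M \<rho> x z' y' t' a \<otimes>\<^bsub>M\<^esub> u"
  have gc: "eval4 R M \<rho> x z u y g \<in> carrier M" using cl u g_closed by (intro \<rho>.eval4_closed)
  have s: "s \<in> carrier M" unfolding s_def using cl u gc by simp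
  have t: "t = s \<ominus>\<^bsub>M\<^esub> u \<otimes>\<^bsub>M\<^esub> eval4 R M \<rho> x z u y g"
    unfolding s_def using cl u gc by (simp add: \<rho>.S.a_minus_cancel)
  have pt': "is_point R M \<rho> d j P Q x z' y' t'"
    using pt point_translate_iff[OF \<rho> cl(1-3) s u] unfolding t'_def z'_def y'_def t[symmetric] by simp
  then have cl': "z' \<in> carrier M" "y' \<in> carrier M" "t' \<in> carrier M" by (auto simp: is_point_def)
  have v: "v \<in> carrier M" unfolding v_def
    using cl cl' u s a_closed b_closed by (simp add: \<rho>.eval4_closed)
  show ?thesis
    by (rule that[OF _ z'_def y'_def s_def t t'_def v_def _ s])
       (simp_all add: descend_def Let_def z'_def y'_def s_def t'_def v_def cylinder_points_def
         pt'[unfolded t'_def z'_def y'_def s_def] v[unfolded v_def t'_def z'_def y'_def s_def])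
qed

lemma ascend_cases:
  assumes \<rho>: "ring_hom_cring R M \<rho>" and \<tau>: "(x, z', y', t', v) \<in> cylinder_points R M \<rho> d j P Q"
  obtains z y t s u where "ascend M \<rho> (x, z', y', t', v) = (x, z, y, t, u)"
    and "u = eval4 R M \<rho> x z' y' t' b \<otimes>\<^bsub>M\<^esub> t' \<ominus>\<^bsub>M\<^esub> x \<otimes>\<^bsub>M\<^esub> v"
    and "s = eval4 R M \<rho> x z' y' t' a \<otimes>\<^bsub>M\<^esub> t' \<oplus>\<^bsub>M\<^esub> eval3 R M \<rho> x z' y' c \<otimes>\<^bsub>M\<^esub> v"
    and "z' = translate_Z M d j x z u" "y' = translate_Y R M \<rho> j w x z u y"
    and "s = t \<oplus>\<^bsub>M\<^esub> u \<otimes>\<^bsub>M\<^esub> eval4 R M \<rho> x z u y g"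
    and "t' = x \<otimes>\<^bsub>M\<^esub> s \<oplus>\<^bsub>M\<^esub> eval3 R M \<rho> x z' y' c \<otimes>\<^bsub>M\<^esub> u"
    and "v = eval4 R M \<rho> x z' y' t' b \<otimes>\<^bsub>M\<^esub> s \<ominus>\<^bsub>M\<^esub> eval4 R M \<rho> x z' y' t' a \<otimes>\<^bsub>M\<^esub> u"
    and "(x, z, y, t, u) \<in> cylinder_points R M \<rho> d (Suc j) P Q"
proof -
  interpret \<rho>: ring_hom_cring R M \<rho> by fact
  have pt: "is_point R M \<rho> d j P Q x z' y' t'" and v: "v \<in> carrier M"
    using \<tau> by (auto simp: cylinder_points_def)
  have cl: "x \<in> carrier M" "z' \<in> carrier M" "y' \<in> carrier M" "t' \<in> carrier M"
    using pt by (auto simp: is_point_def)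
  define a' b' c' where "a' = eval4 R M \<rho> x z' y' t' a" and "b' = eval4 R M \<rho> x z' y' t' b"
    and "c' = eval3 R M \<rho> x z' y' c"
  have abc: "a' \<in> carrier M" "b' \<in> carrier M" "c' \<in> carrier M"
    unfolding a'_def b'_def c'_def using cl a_closed b_closed c_closed
    by (auto intro!: \<rho>.eval4_closed \<rho>.eval3_closed)
  have one: "x \<otimes>\<^bsub>M\<^esub> a' \<oplus>\<^bsub>M\<^esub> b' \<otimes>\<^bsub>M\<^esub> c' = \<one>\<^bsub>M\<^esub>"
    using bezout_at[OF \<rho> pt] unfolding a'_def b'_def c'_def .
  define u s where "u = b' \<otimes>\<^bsub>M\<^esub> t' \<ominus>\<^bsub>M\<^esub> x \<otimes>\<^bsub>M\<^esub> v" and "s = a' \<otimes>\<^bsub>M\<^esub> t' \<oplus>\<^bsub>M\<^esub> c' \<otimes>\<^bsub>M\<^esub> v"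
  have us: "u \<in> carrier M" "s \<in> carrier M" unfolding u_def s_def using abc cl v by auto
  define z where "z = z' \<ominus>\<^bsub>M\<^esub> x [^]\<^bsub>M\<^esub> d \<otimes>\<^bsub>M\<^esub> x [^]\<^bsub>M\<^esub> j \<otimes>\<^bsub>M\<^esub> u"
  have z: "z \<in> carrier M" unfolding z_def using cl us by simp
  define y where "y = y' \<ominus>\<^bsub>M\<^esub> x [^]\<^bsub>M\<^esub> j \<otimes>\<^bsub>M\<^esub> u \<otimes>\<^bsub>M\<^esub> slope R M \<rho> w x z u"
  note k = \<rho>.translations_closed(1)[OF cl(1) z us(1) w_closed]
  have y: "y \<in> carrier M" unfolding y_def using cl us k by simp
  define t where "t = s \<ominus>\<^bsub>M\<^esub> u \<otimes>\<^bsub>M\<^esub> eval4 R M \<rho> x z u y g"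
  have gc: "eval4 R M \<rho> x z u y g \<in> carrier M" using cl us z y g_closed by (intro \<rho>.eval4_closed)
  have z'_eq: "z' = translate_Z M d j x z u"
    unfolding translate_Z_def z_def using cl us by (simp add: \<rho>.S.a_minus_cancel)
  have y'_eq: "y' = translate_Y R M \<rho> j w x z u y"
    unfolding translate_Y_def y_def using cl us k by (simp add: \<rho>.S.a_minus_cancel)
  have s_eq: "s = t \<oplus>\<^bsub>M\<^esub> u \<otimes>\<^bsub>M\<^esub> eval4 R M \<rho> x z u y g"
    unfolding t_def using us gc by (simp add: \<rho>.S.a_minus_cancel)
  have t'_eq: "t' = x \<otimes>\<^bsub>M\<^esub> s \<oplus>\<^bsub>M\<^esub> c' \<otimes>\<^bsub>M\<^esub> u"
    unfolding s_def u_def by (rule \<rho>.S.solve_linear(1)[OF cl(1) abc cl(4) v one, symmetric])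
  have v_eq: "v = b' \<otimes>\<^bsub>M\<^esub> s \<ominus>\<^bsub>M\<^esub> a' \<otimes>\<^bsub>M\<^esub> u"
    unfolding s_def u_def by (rule \<rho>.S.solve_linear(2)[OF cl(1) abc cl(4) v one, symmetric])
  have "is_point R M \<rho> d (Suc j) P Q x z y t"
    using pt point_translate_iff[OF \<rho> cl(1) z y us(2,1)]
    unfolding t_def z'_eq[symmetric] y'_eq[symmetric] c'_def[symmetric] t'_eq[symmetric] by simp
  then have "(x, z, y, t, u) \<in> cylinder_points R M \<rho> d (Suc j) P Q" using us by (simp add: cylinder_points_def)
  moreover have "ascend M \<rho> (x, z', y', t', v) = (x, z, y, t, u)"
    unfolding ascend_def Let_def prod.case a'_def[symmetric] b'_def[symmetric] c'_def[symmetric]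
      u_def[symmetric] s_def[symmetric] z_def[symmetric] y_def[symmetric] t_def[symmetric] ..
  ultimately show ?thesis
    using that[of z y t u s] u_def s_def z'_eq y'_eq s_eq t'_eq v_eq
    unfolding a'_def b'_def c'_def by blast
qed

lemma descend_in:
  assumes "ring_hom_cring R M \<rho>" "\<tau> \<in> cylinder_points R M \<rho> d (Suc j) P Q"
  shows "descend M \<rho> \<tau> \<in> cylinder_points R M \<rho> d j P Q"
proof (cases \<tau>)
  case (fields x z y t u)
  obtain z' y' t' v where "descend M \<rho> (x, z, y, t, u) = (x, z', y', t', v)"
    and "(x, z', y', t', v) \<in> cylinder_points R M \<rho> d j P Q"
    using descend_cases[OF assms(1) assms(2)[unfolded fields]] .
  then show ?thesis unfolding fields by (simp only:)
qed

lemma ascend_in: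
  assumes "ring_hom_cring R M \<rho>" "\<tau> \<in> cylinder_points R M \<rho> d j P Q"
  shows "ascend M \<rho> \<tau> \<in> cylinder_points R M \<rho> d (Suc j) P Q"
proof (cases \<tau>)
  case (fields x z' y' t' v)
  obtain z y t u where "ascend M \<rho> (x, z', y', t', v) = (x, z, y, t, u)"
    and "(x, z, y, t, u) \<in> cylinder_points R M \<rho> d (Suc j) P Q"
    using ascend_cases[OF assms(1) assms(2)[unfolded fields]] .
  then show ?thesis unfolding fields by (simp only:)
qed

lemma descend_ascend:
  assumes \<rho>: "ring_hom_cring R M \<rho>" and \<tau>: "\<tau> \<in> cylinder_points R M \<rho> d j P Q"
  shows "descend M \<rho> (ascend M \<rho> \<tau>) = \<tau>"
proof (cases \<tau>)
  case (fields x z' y' t' v)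
  obtain z y t s u where b: "ascend M \<rho> (x, z', y', t', v) = (x, z, y, t, u)"
    and e: "z' = translate_Z M d j x z u" "y' = translate_Y R M \<rho> j w x z u y"
      "s = t \<oplus>\<^bsub>M\<^esub> u \<otimes>\<^bsub>M\<^esub> eval4 R M \<rho> x z u y g"
      "t' = x \<otimes>\<^bsub>M\<^esub> s \<oplus>\<^bsub>M\<^esub> eval3 R M \<rho> x z' y' c \<otimes>\<^bsub>M\<^esub> u"
      "v = eval4 R M \<rho> x z' y' t' b \<otimes>\<^bsub>M\<^esub> s \<ominus>\<^bsub>M\<^esub> eval4 R M \<rho> x z' y' t' a \<otimes>\<^bsub>M\<^esub> u"
    using ascend_cases[OF \<rho> \<tau>[unfolded fields]] .
  show ?thesis
    unfolding fields b descend_def Let_def prod.case e(1,2)[symmetric] e(3)[symmetric] e(4)[symmetric]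
      e(5)[symmetric] ..
qed

lemma ascend_descend:
  assumes \<rho>: "ring_hom_cring R M \<rho>" and \<tau>: "\<tau> \<in> cylinder_points R M \<rho> d (Suc j) P Q"
  shows "ascend M \<rho> (descend M \<rho> \<tau>) = \<tau>"
proof (cases \<tau>)
  case (fields x z y t u)
  interpret \<rho>: ring_hom_cring R M \<rho> by fact
  obtain z' y' t' s v where f: "descend M \<rho> (x, z, y, t, u) = (x, z', y', t', v)"
    and e: "z' = translate_Z M d j x z u" "y' = translate_Y R M \<rho> j w x z u y"
      "t = s \<ominus>\<^bsub>M\<^esub> u \<otimes>\<^bsub>M\<^esub> eval4 R M \<rho> x z u y g"
      "t' = x \<otimes>\<^bsub>M\<^esub> s \<oplus>\<^bsub>M\<^esub> eval3 R M \<rho> x z' y' c \<otimes>\<^bsub>M\<^esub> u"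
      "v = eval4 R M \<rho> x z' y' t' b \<otimes>\<^bsub>M\<^esub> s \<ominus>\<^bsub>M\<^esub> eval4 R M \<rho> x z' y' t' a \<otimes>\<^bsub>M\<^esub> u"
    and \<tau>': "(x, z', y', t', v) \<in> cylinder_points R M \<rho> d j P Q" and s: "s \<in> carrier M"
    using descend_cases[OF \<rho> \<tau>[unfolded fields]] .
  have pt: "is_point R M \<rho> d j P Q x z' y' t'" using \<tau>' by (auto simp: cylinder_points_def)
  have cl: "x \<in> carrier M" "z' \<in> carrier M" "y' \<in> carrier M" "t' \<in> carrier M"
    using pt by (auto simp: is_point_def)
  have cl1: "z \<in> carrier M" "y \<in> carrier M" "u \<in> carrier M"
    using \<tau> unfolding fields cylinder_points_def is_point_def by auto
  define a' b' c' where "a' = eval4 R M \<rho> x z' y' t' a" and "b' = eval4 R M \<rho> x z' y' t' b"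
    and "c' = eval3 R M \<rho> x z' y' c"
  have abc: "a' \<in> carrier M" "b' \<in> carrier M" "c' \<in> carrier M"
    unfolding a'_def b'_def c'_def using cl a_closed b_closed c_closed
    by (auto intro!: \<rho>.eval4_closed \<rho>.eval3_closed)
  have one: "x \<otimes>\<^bsub>M\<^esub> a' \<oplus>\<^bsub>M\<^esub> b' \<otimes>\<^bsub>M\<^esub> c' = \<one>\<^bsub>M\<^esub>"
    using bezout_at[OF \<rho> pt] unfolding a'_def b'_def c'_def .
  note sol = \<rho>.S.solve_linear'[OF cl(1) abc s cl1(3) one, folded e(4)[folded c'_def] e(5)[folded a'_def b'_def]]
  note k = \<rho>.translations_closed(1)[OF cl(1) cl1(1,3) w_closed]
  have ez: "z' \<ominus>\<^bsub>M\<^esub> x [^]\<^bsub>M\<^esub> d \<otimes>\<^bsub>M\<^esub> x [^]\<^bsub>M\<^esub> j \<otimes>\<^bsub>M\<^esub> u = z"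
    unfolding e(1) translate_Z_def using cl cl1 by (simp add: \<rho>.S.a_minus_cancel)
  have ey: "y' \<ominus>\<^bsub>M\<^esub> x [^]\<^bsub>M\<^esub> j \<otimes>\<^bsub>M\<^esub> u \<otimes>\<^bsub>M\<^esub> slope R M \<rho> w x z u = y"
    unfolding e(2) translate_Y_def using cl cl1 k by (simp add: \<rho>.S.a_minus_cancel)
  show ?thesis
    unfolding fields f ascend_def Let_def prod.case a'_def[symmetric] b'_def[symmetric] c'_def[symmetric]
      sol ez ey e(3)[symmetric] ..
qed

text \<open>
  Naturality of \<open>descend\<close>. That of \<open>ascend\<close> is inherited (\<open>hom_ascend\<close>), since \<open>ascend\<close> is the
  inverse of \<open>descend\<close>.
\<close>

lemma hom_descend:
  assumes h: "ring_hom_cring R M h" and k: "ring_hom_cring R N k" and f: "ring_hom_cring M N f"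
    and hk: "\<And>r. r \<in> carrier R \<Longrightarrow> f (h r) = k r"
    and \<tau>: "\<tau> \<in> cylinder_points R M h d (Suc j) P Q"
  shows "map5 f (descend M h \<tau>) = descend N k (map5 f \<tau>)"
proof (cases \<tau>)
  case (fields x z y t u)
  interpret h: ring_hom_cring R M h by fact
  interpret f: ring_hom_cring M N f by fact
  have cl: "x \<in> carrier M" "z \<in> carrier M" "y \<in> carrier M" "t \<in> carrier M" "u \<in> carrier M"
    using \<tau> unfolding fields by (auto simp: cylinder_points_def is_point_def)
  note m = hom_translations(1,2)[OF h k f hk cl(1,2,5) w_closed] hom_translations(3)[OF h k f hk cl(1,2,5) w_closed cl(3)]
  note mc = h.translations_closed(1,2)[OF cl(1,2,5) w_closed] h.translations_closed(3)[OF cl(1,2,5) w_closed cl(3)]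
  show ?thesis
    unfolding fields descend_def map5_def Let_def prod.case
    using cl mc a_closed b_closed c_closed g_closed
    by (simp add: ring_hom_cring.hom_sub[OF f] hom_eval4[OF h k f hk] hom_eval3[OF h k f hk] m
      h.eval4_closed h.eval3_closed)
qed

lemma hom_cylinder_points:
  assumes h: "ring_hom_cring R M h" and k: "ring_hom_cring R N k" and f: "ring_hom_cring M N f"
    and hk: "\<And>r. r \<in> carrier R \<Longrightarrow> f (h r) = k r"
    and \<tau>: "\<tau> \<in> cylinder_points R M h d i P Q"
  shows "map5 f \<tau> \<in> cylinder_points R N k d i P Q"
proof (cases \<tau>)
  case (fields x z y t u)
  interpret h: ring_hom_cring R M h by fact
  interpret f: ring_hom_cring M N f by fact
  have cl: "x \<in> carrier M" "z \<in> carrier M" "y \<in> carrier M" "t \<in> carrier M" "u \<in> carrier M"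
    and e: "x [^]\<^bsub>M\<^esub> d \<otimes>\<^bsub>M\<^esub> y = eval2 R M h x z P" "x [^]\<^bsub>M\<^esub> i \<otimes>\<^bsub>M\<^esub> t = eval3 R M h x z y Q"
    using \<tau> unfolding fields by (auto simp: cylinder_points_def is_point_def)
  show ?thesis
    using arg_cong[where f = f, OF e(1)] arg_cong[where f = f, OF e(2)] cl P_closed Q_closed
    by (simp add: fields map5_def cylinder_points_def is_point_def hom_eval2[OF h k f hk] hom_eval3[OF h k f hk])
qed

lemma hom_ascend:
  assumes h: "ring_hom_cring R M h" and k: "ring_hom_cring R N k" and f: "ring_hom_cring M N f"
    and hk: "\<And>r. r \<in> carrier R \<Longrightarrow> f (h r) = k r"
    and \<tau>: "\<tau> \<in> cylinder_points R M h d j P Q"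
  shows "map5 f (ascend M h \<tau>) = ascend N k (map5 f \<tau>)"
proof -
  have "map5 f (ascend M h \<tau>) = ascend N k (descend N k (map5 f (ascend M h \<tau>)))"
    by (rule ascend_descend[OF k hom_cylinder_points[OF h k f hk ascend_in[OF h \<tau>]], symmetric])
  also have "descend N k (map5 f (ascend M h \<tau>)) = map5 f (descend M h (ascend M h \<tau>))"
    by (rule hom_descend[OF h k f hk ascend_in[OF h \<tau>], symmetric])
  finally show ?thesis unfolding descend_ascend[OF h \<tau>] .
qed

end

lemma map5_comp: "map5 f (map5 g \<tau>) = map5 (\<lambda>c. f (g c)) \<tau>"
  by (cases \<tau>) (simp add: map5_def)

lemma map5_id: "map5 (\<lambda>c. c) \<tau> = \<tau>"
  by (cases \<tau>) (simp add: map5_def)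

context cylinder_exchange
begin

text \<open>
  Yoneda: \<open>\<phi>\<close> and \<open>\<psi>\<close> are the homomorphisms that classify the images of the generic points. By
  naturality their composites fix the generic points, hence are identities.
\<close>

lemma cylinder_isomorphic:
  "alg_isomorphic R
     (UP (B_ring R d (Suc j) P Q))
     (\<lambda>r. cst (B_ring R d (Suc j) P Q) (B_incl R d (Suc j) P Q r))
     (UP (B_ring R d j P Q))
     (\<lambda>r. cst (B_ring R d j P Q) (B_incl R d j P Q r))"
proof -
  interpret S: B_algebra R d "Suc j" P Q by unfold_locales
  let ?C = "UP (B_ring R d (Suc j) P Q)" and ?D = "UP (B_ring R d j P Q)"
  define \<alpha> where "\<alpha> r = S.to_cylinder (const4 R r)" for r
  define \<beta> where "\<beta> r = to_cylinder (const4 R r)" for r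
  have \<alpha>: "ring_hom_cring R ?C \<alpha>" using S.structure_map_is_hom unfolding \<alpha>_def[abs_def] .
  have \<beta>: "ring_hom_cring R ?D \<beta>" using structure_map_is_hom unfolding \<beta>_def[abs_def] .
  have \<sigma>: "S.generic_point \<in> cylinder_points R ?C \<alpha> d (Suc j) P Q"
    using S.generic_point_in unfolding \<alpha>_def[abs_def] .
  have \<tau>: "generic_point \<in> cylinder_points R ?D \<beta> d j P Q"
    using generic_point_in unfolding \<beta>_def[abs_def] .
  obtain \<phi> where \<phi>: "ring_hom_cring ?D ?C \<phi>" and \<phi>r: "\<And>r. r \<in> carrier R \<Longrightarrow> \<phi> (\<beta> r) = \<alpha> r"
    and \<phi>\<tau>: "map5 \<phi> generic_point = descend ?C \<alpha> S.generic_point"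
    using hom_from_cylinder[OF \<alpha> descend_in[OF \<alpha> \<sigma>]] unfolding \<beta>_def[symmetric] by blast
  obtain \<psi> where \<psi>: "ring_hom_cring ?C ?D \<psi>" and \<psi>r: "\<And>r. r \<in> carrier R \<Longrightarrow> \<psi> (\<alpha> r) = \<beta> r"
    and \<psi>\<sigma>: "map5 \<psi> S.generic_point = ascend ?D \<beta> generic_point"
    using S.hom_from_cylinder[OF \<beta> ascend_in[OF \<beta> \<tau>]] unfolding \<alpha>_def[symmetric] by blast
  have idC: "ring_hom_cring ?C ?C (\<lambda>c. c)" and idD: "ring_hom_cring ?D ?D (\<lambda>c. c)"
    by (intro ring_hom_cringI cring_UP S.cring_B cring_B ring_hom_memI; simp)+
  note \<phi>h = ring_hom_cring.homh[OF \<phi>] and \<psi>h = ring_hom_cring.homh[OF \<psi>]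
  have \<psi>\<phi>: "ring_hom_cring ?D ?D (\<lambda>c. \<psi> (\<phi> c))"
    using ring_hom_trans[OF \<phi>h \<psi>h] by (intro ring_hom_cringI cring_UP cring_B) (simp add: comp_def)
  have \<phi>\<psi>: "ring_hom_cring ?C ?C (\<lambda>c. \<phi> (\<psi> c))"
    using ring_hom_trans[OF \<psi>h \<phi>h] by (intro ring_hom_cringI cring_UP S.cring_B) (simp add: comp_def)
  have "map5 (\<lambda>c. \<psi> (\<phi> c)) generic_point = generic_point"
  proof -
    have "map5 \<psi> (descend ?C \<alpha> S.generic_point) = descend ?D \<beta> (map5 \<psi> S.generic_point)"
      by (rule hom_descend[OF \<alpha> \<beta> \<psi> \<psi>r \<sigma>])
    then show ?thesis
      unfolding map5_comp[symmetric] \<phi>\<tau> \<psi>\<sigma> descend_ascend[OF \<beta> \<tau>] .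
  qed
  then have inv1: "\<psi> (\<phi> c) = c" if "c \<in> carrier ?D" for c
    using cylinder_hom_eqI[OF \<psi>\<phi> idD _ _ that] by (simp add: map5_id \<phi>r \<psi>r flip: \<beta>_def)
  have "map5 (\<lambda>c. \<phi> (\<psi> c)) S.generic_point = S.generic_point"
  proof -
    have "map5 \<phi> (ascend ?D \<beta> generic_point) = ascend ?C \<alpha> (map5 \<phi> generic_point)"
      by (rule hom_ascend[OF \<beta> \<alpha> \<phi> \<phi>r \<tau>])
    then show ?thesis
      unfolding map5_comp[symmetric] \<phi>\<tau> \<psi>\<sigma> ascend_descend[OF \<alpha> \<sigma>] .
  qed
  then have inv2: "\<phi> (\<psi> c) = c" if "c \<in> carrier ?C" for c
    using S.cylinder_hom_eqI[OF \<phi>\<psi> idC _ _ that] by (simp add: map5_id \<phi>r \<psi>r flip: \<alpha>_def)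
  have "bij_betw \<psi> (carrier ?C) (carrier ?D)"
    by (rule bij_betw_byWitness[where f' = \<phi>])
       (use inv1 inv2 ring_hom_closed[OF \<phi>h] ring_hom_closed[OF \<psi>h] in auto)
  then have "\<psi> \<in> ring_iso ?C ?D" using \<psi>h by (simp add: ring_iso_def)
  moreover have "cst (B_ring R d (Suc j) P Q) (B_incl R d (Suc j) P Q r) = \<alpha> r"
    "cst (B_ring R d j P Q) (B_incl R d j P Q r) = \<beta> r" for r
    unfolding \<alpha>_def \<beta>_def S.to_cylinder_def to_cylinder_def S.proj_def proj_def B_incl_def const4_def by simp_all
  ultimately show ?thesis unfolding alg_isomorphic_def using \<psi>r by auto
qed

end

theorem theorem3p5:
  fixes k :: "('k, 'n) ring_scheme"
    and R :: "('k, 'a, 'm) module_scheme"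
    and d e m s :: nat
    and P :: "nat \<Rightarrow> nat \<Rightarrow> 'a"
    and Q :: "nat \<Rightarrow> nat \<Rightarrow> nat \<Rightarrow> 'a"
    and bs :: 'a
  assumes "field k"
    and "factorial_affine_domain k R"
    and "d \<ge> 1"
    and "e > 1"
    and "P \<in> carrier (UP (UP R))"
    and "deg (UP R) P = m"
    and "coeff (UP (UP R)) P m = \<one>\<^bsub>UP R\<^esub>"
    and "m > 1"
    and "Q \<in> carrier (UP (UP (UP R)))"
    and "deg (UP (UP R)) Q = s"
    and "s \<ge> 1"
    and "bs \<in> carrier R - {\<zero>\<^bsub>R\<^esub>}"
    and "coeff (UP (UP (UP R))) Q s = cst (UP R) (cst R bs)"
    and "Idl\<^bsub>UP R\<^esub> {subst0_XZ R P, subst0_XZ R (formal_deriv (UP R) P)} = carrier (UP R)"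
    and "Idl\<^bsub>UP (UP R)\<^esub> {cst (UP R) (subst0_XZ R P), subst0_XYZ R Q,
           subst0_XYZ R (formal_deriv (UP (UP R)) Q)} = carrier (UP (UP R))"
  shows "alg_isomorphic R
           (UP (B_ring R d e P Q))
           (\<lambda>r. cst (B_ring R d e P Q) (B_incl R d e P Q r))
           (UP (B_ring R d (e - 1) P Q))
           (\<lambda>r. cst (B_ring R d (e - 1) P Q) (B_incl R d (e - 1) P Q r))"
proof -
  define j where "j = e - 1"
  have j: "e = Suc j" "j \<ge> 1" using assms(4) by (auto simp: j_def)
  have R: "cring R"
    using assms(2) by (simp add: factorial_affine_domain_def algebra_def)
  define c where "c = cst (UP (UP R)) (formal_deriv (UP R) P) \<otimes>\<^bsub>UP (UP (UP R))\<^esub> formal_deriv (UP (UP R)) Q"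
  interpret B_algebra R d j P Q using R assms(5,9) by (rule B_algebra.intro)
  interpret c1: ring_hom_cring "UP R" "UP (UP R)" "cst (UP R)" by (intro cst_is_hom cring_UP R)
  interpret c2: ring_hom_cring "UP (UP R)" "UP (UP (UP R))" "cst (UP (UP R))"
    by (intro cst_is_hom cring_UP R)
  have c: "c \<in> carrier (UP (UP (UP R)))"
    unfolding c_def using assms(5,9) by simp
  obtain a b where "a \<in> carrier G" "b \<in> carrier G"
    "proj (var1 R) \<otimes>\<^bsub>B\<^esub> proj a \<oplus>\<^bsub>B\<^esub> proj b \<otimes>\<^bsub>B\<^esub> proj (cst (UP (UP (UP R))) c) = \<one>\<^bsub>B\<^esub>"
    using bezout_in_B[OF assms(3) j(2) assms(14,15) c_def] by blast
  moreover obtain w g where "w \<in> carrier G" "g \<in> carrier G"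
    "translates_P R G (const4 R) d j P w (var1 R) (var2 R) (var3 R)"
    "translates_Q R G (const4 R) d j Q w g c (var1 R) (var2 R) (var3 R) (var4 R)"
    using translation_polynomials_exist[OF R assms(5,9,3) j(2) c_def] by blast
  ultimately interpret cylinder_exchange R d j P Q w g a b c
    using c by unfold_locales
  show ?thesis using cylinder_isomorphic unfolding j by simp
qed

end
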